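(* For every $\varepsilon>0$ there exist $\delta>0$ and $n_0$ such that the following holds for all $n\ge n_0$. If $G$ is a graph on $n$ vertices that contains no cycle of length $4$ (i.e. $G$ is $C_4$-free) and contains at most $\delta n^{5/2}$ copies of the $5$-cycle $C_5$, then $G$ can be made $C_5$-free by removing at most $\varepsilon n^{3/2}$ edges.
   Context: A copy of $C_k$ in a graph $G$ means a subgraph of $G$ isomorphic to the cycle $C_k$ on $k$ vertices. Equivalently, the statement says: an $n$-vertex $C_4$-free graph with $o(n^{5/2})$ copies of $C_5$ can be made $C_5$-free by removing $o(n^{3/2})$ edges. *)

theory Defs
  imports Complex_Main
begin

definition graph_on :: "nat \<Rightarrow> nat set set \<Rightarrow> bool" where
  "graph_on n E \<longleftrightarrow> (\<forall>e\<in>E. \<exists>u v. u \<noteq> v \<and> u < n \<and> v < n \<and> e = {u, v})"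

definition cycle_edges :: "nat \<Rightarrow> (nat \<Rightarrow> nat) \<Rightarrow> nat set set" where
  "cycle_edges k f = (\<lambda>i. {f i, f (Suc i mod k)}) ` {..<k}"

text \<open>The copies of the cycle C_k (k >= 3) in the graph with edge set E: the subgraphs
  of E isomorphic to C_k, each identified with its edge set (a cycle subgraph has no
  isolated vertices, so its edge set determines it).\<close>

definition cycle_copies :: "nat \<Rightarrow> nat set set \<Rightarrow> nat set set set" where
  "cycle_copies k E =
     {C. \<exists>f. inj_on f {..<k} \<and> C = cycle_edges k f \<and> C \<subseteq> E}"

definition cycle_free :: "nat \<Rightarrow> nat set set \<Rightarrow> bool" where
  "cycle_free k E \<longleftrightarrow> cycle_copies k E = {}"

end

theory Submission
  imports Defs "HOL-Analysis.Convex"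
begin

text \<open>
  Write \<open>r = sqrt n\<close>, so that \<open>r ^ 3\<close> edges and \<open>r ^ 5\<close> copies of the 5-cycle are the
  natural scales. Delete first the edges at vertices of degree above \<open>K * r\<close>; they are few, because
  in a graph without 4-cycles the squared degrees sum to at most \<open>2 * n\<^sup>2\<close>. For the remaining graph
  the mean square density of a partition into boundedly many parts is bounded at the sparse scale,
  and an energy increment argument yields partitions \<open>P\<close>, \<open>Q\<close>, \<open>R\<close>, each refining the previous one,
  of nearly equal energy, where \<open>Q\<close> approximates the graph in cut norm to a precision depending on
  the number of parts of \<open>P\<close>, and \<open>R\<close> to a precision depending on the number of parts of \<open>Q\<close>.

  Delete the edges in small parts of \<open>P\<close>, in pairs of parts of low density, and in pairs where the
  density of \<open>Q\<close> or \<open>R\<close> is often much smaller than that of \<open>P\<close>; closeness of the energies makes the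
  last kind rare. If a 5-cycle survives in the parts \<open>V1, ..., V5\<close>, then in the count of closed
  walks through these parts the edges can be replaced by the densities one at a time. Two distinct
  vertices have at most one common neighbour, so paths of length two form a 0/1-valued kernel, and cut
  norm control by \<open>Q\<close> suffices for three consecutive edges. The weight then left on the ends of the
  last two edges is constant on the cells of \<open>Q\<close>, and the degrees into these cells are controlled by
  \<open>R\<close>. In the dense kernel that results nearly every pair is present, so a union bound produces
  of order \<open>r ^ 5\<close> closed walks, of which all but order \<open>r ^ 4\<close> are genuine 5-cycles.
\<close>

section \<open>Averages over partitions and their energy\<close>

definition fibre :: "'u set \<Rightarrow> ('u \<Rightarrow> 'l) \<Rightarrow> 'u \<Rightarrow> 'u set" where
  "fibre U l u = {v \<in> U. l v = l u}"

text \<open>The conditional expectation of \<open>f\<close> on the level sets of \<open>l\<close>,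
  for the uniform measure on \<open>U\<close>. Partitions are encoded as labellings, so a bounded
  range of labels means boundedly many parts.\<close>

definition avg :: "'u set \<Rightarrow> ('u \<Rightarrow> 'l) \<Rightarrow> ('u \<Rightarrow> real) \<Rightarrow> 'u \<Rightarrow> real" where
  "avg U l f u = sum f (fibre U l u) / card (fibre U l u)"

definition energy :: "'u set \<Rightarrow> ('u \<Rightarrow> 'l) \<Rightarrow> ('u \<Rightarrow> real) \<Rightarrow> real" where
  "energy U l f = (\<Sum>u\<in>U. (avg U l f u)\<^sup>2)"

definition refines :: "'u set \<Rightarrow> ('u \<Rightarrow> 'm) \<Rightarrow> ('u \<Rightarrow> 'l) \<Rightarrow> bool" where
  "refines U m l \<longleftrightarrow> (\<forall>u\<in>U. \<forall>v\<in>U. m u = m v \<longrightarrow> l u = l v)"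

lemma refines_refl: "refines U l l"
  by (simp add: refines_def)

lemma refines_trans: "refines U m l \<Longrightarrow> refines U l k \<Longrightarrow> refines U m k"
  unfolding refines_def by blast

lemma fibre_cong: "l u = l v \<Longrightarrow> fibre U l u = fibre U l v"
  by (simp add: fibre_def)

lemma avg_cong: "l u = l v \<Longrightarrow> avg U l f u = avg U l f v"
  by (simp add: avg_def fibre_def)

text \<open>Both sides are one double sum over pairs with equal labels, weighted by the reciprocal
  of the common fibre size, which is symmetric in the pair.\<close>

lemma avg_selfadjoint:
  assumes "finite U"
  shows "(\<Sum>u\<in>U. avg U l f u * g u) = (\<Sum>u\<in>U. f u * avg U l g u)"
proof -
  have e: "(\<Sum>v\<in>fibre U l u. c v) = (\<Sum>v\<in>U. of_bool (l v = l u) * c v)" for u and c :: "'a \<Rightarrow> real"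
    using assms by (intro sum.mono_neutral_cong_left) (auto simp: fibre_def)
  have "(\<Sum>u\<in>U. avg U l f u * g u)
      = (\<Sum>u\<in>U. \<Sum>v\<in>U. of_bool (l v = l u) * f v / card (fibre U l u) * g u)"
    by (simp add: avg_def e sum_divide_distrib sum_distrib_right)
  also have "\<dots> = (\<Sum>v\<in>U. \<Sum>u\<in>U. of_bool (l v = l u) * f v / card (fibre U l u) * g u)"
    by (rule sum.swap)
  also have "\<dots> = (\<Sum>v\<in>U. \<Sum>u\<in>U. f v * (of_bool (l u = l v) * g u / card (fibre U l v)))"
  proof (intro sum.cong refl)
    fix v u
    show "of_bool (l v = l u) * f v / card (fibre U l u) * g u
        = f v * (of_bool (l u = l v) * g u / card (fibre U l v))"
    proof (cases "l u = l v")
      case True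
      then show ?thesis by (simp add: fibre_cong[where l = l, OF True])
    qed auto
  qed
  also have "\<dots> = (\<Sum>u\<in>U. f u * avg U l g u)"
    by (simp add: avg_def e sum_divide_distrib sum_distrib_left)
  finally show ?thesis .
qed

lemma avg_fixed:
  assumes "finite U" "u \<in> U" "\<And>v. v \<in> U \<Longrightarrow> l v = l u \<Longrightarrow> g v = g u"
  shows "avg U l g u = g u"
proof -
  have "sum g (fibre U l u) = sum (\<lambda>_. g u) (fibre U l u)"
    using assms(3) by (intro sum.cong) (auto simp: fibre_def)
  moreover have "card (fibre U l u) \<noteq> 0"
    using assms by (auto simp: fibre_def)
  ultimately show ?thesis by (simp add: avg_def)
qed

text \<open>Averaging is selfadjoint and fixes functions that are constant on fibres, so against
  such a function an average can be exchanged for \<open>f\<close> itself.\<close>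

lemma sum_avg_mult:
  assumes "finite U" "\<And>u v. u \<in> U \<Longrightarrow> v \<in> U \<Longrightarrow> l v = l u \<Longrightarrow> g v = g u"
  shows "(\<Sum>u\<in>U. avg U l f u * g u) = (\<Sum>u\<in>U. f u * g u)"
proof -
  have "avg U l g u = g u" if "u \<in> U" for u
    using assms(1) that by (rule avg_fixed) (rule assms(2)[OF that])
  then show ?thesis
    unfolding avg_selfadjoint[OF assms(1)] by simp
qed

text \<open>Pythagoras: the square of the coarse average and its product with the fine average both
  reduce to the sum of \<open>f\<close> times the coarse average.\<close>

lemma energy_diff:
  assumes "finite U" "refines U m l"
  shows "energy U m f - energy U l f = (\<Sum>u\<in>U. (avg U m f u - avg U l f u)\<^sup>2)"
proof -
  have 1: "(\<Sum>u\<in>U. avg U l f u * avg U l f u) = (\<Sum>u\<in>U. f u * avg U l f u)"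
    using assms(1) by (rule sum_avg_mult) (rule avg_cong[of l])
  have 2: "(\<Sum>u\<in>U. avg U m f u * avg U l f u) = (\<Sum>u\<in>U. f u * avg U l f u)"
    using assms(1)
  proof (rule sum_avg_mult)
    fix u v assume "u \<in> U" "v \<in> U" "m v = m u"
    then have "l v = l u" using assms(2) unfolding refines_def by blast
    then show "avg U l f v = avg U l f u" by (rule avg_cong[of l])
  qed
  have "(\<Sum>u\<in>U. (avg U m f u - avg U l f u)\<^sup>2)
      = energy U m f + (\<Sum>u\<in>U. avg U l f u * avg U l f u) - 2 * (\<Sum>u\<in>U. avg U m f u * avg U l f u)"
    by (simp add: energy_def power2_eq_square algebra_simps sum.distrib sum_subtractf sum_distrib_left)
  then show ?thesis using 1 2 by (simp add: energy_def power2_eq_square)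
qed

lemma energy_mono:
  assumes "finite U" "refines U m l"
  shows "energy U l f \<le> energy U m f"
proof -
  have "0 \<le> (\<Sum>u\<in>U. (avg U m f u - avg U l f u)\<^sup>2)"
    by (intro sum_nonneg) simp
  then show ?thesis unfolding energy_diff[OF assms, symmetric] by simp
qed

text \<open>Since \<open>X\<close> is a union of fibres of \<open>m\<close>, \<open>f\<close> and
  its \<open>m\<close>-average have equal sums over \<open>X\<close>. The two averages thus differ
  by more than \<zeta> in sum, and Cauchy-Schwarz against the indicator of \<open>X\<close> turns
  this into a gap of energies.\<close>

lemma energy_increment:
  fixes \<zeta> :: real
  assumes U: "finite U" and ref: "refines U m l" and "X \<subseteq> U"
    and X: "\<And>u v. u \<in> U \<Longrightarrow> v \<in> U \<Longrightarrow> m u = m v \<Longrightarrow> u \<in> X \<Longrightarrow> v \<in> X"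
    and "0 \<le> \<zeta>" and dev: "\<zeta> < (\<Sum>u\<in>X. avg U l f u - f u)"
  shows "\<zeta>\<^sup>2 \<le> card U * (energy U m f - energy U l f)"
proof -
  let ?g = "\<lambda>u. avg U m f u - avg U l f u"
  have ind: "sum g X = (\<Sum>u\<in>U. g u * of_bool (u \<in> X))" for g :: "'a \<Rightarrow> real"
    using \<open>X \<subseteq> U\<close> U by (intro sum.mono_neutral_cong_left) (simp_all add: subset_iff)
  have "of_bool (v \<in> X) = (of_bool (u \<in> X) :: real)" if "u \<in> U" "v \<in> U" "m v = m u" for u v
  proof -
    have "v \<in> X \<longleftrightarrow> u \<in> X"
      using X[OF that(1,2)] X[OF that(2,1)] that(3) by metis
    then show ?thesis by (simp only:)
  qed
  from sum_avg_mult[OF U this] have "sum f X = sum (avg U m f) X"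
    unfolding ind by (rule sym)
  then have "\<zeta> < - sum ?g X"
    using dev by (simp add: sum_subtractf)
  then have "\<zeta>\<^sup>2 \<le> (sum ?g X)\<^sup>2"
    using \<open>0 \<le> \<zeta>\<close> by (intro abs_le_square_iff[THEN iffD1]) linarith
  also have "\<dots> \<le> (\<Sum>u\<in>X. (?g u)\<^sup>2) * (\<Sum>u\<in>X. 1\<^sup>2)"
    using Cauchy_Schwarz_ineq_sum[of ?g "\<lambda>_. 1" X] by simp
  also have "\<dots> \<le> (\<Sum>u\<in>U. (?g u)\<^sup>2) * card U"
  proof (rule mult_mono)
    show "(\<Sum>u\<in>X. (?g u)\<^sup>2) \<le> (\<Sum>u\<in>U. (?g u)\<^sup>2)"
      using \<open>X \<subseteq> U\<close> U by (intro sum_mono2) simp_all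
    show "(\<Sum>u\<in>X. 1\<^sup>2) \<le> real (card U)"
      using card_mono[OF U \<open>X \<subseteq> U\<close>] by simp
  qed (simp_all add: sum_nonneg)
  finally show ?thesis
    unfolding energy_diff[OF U ref] mult.commute[of "real (card U)"] .
qed

section \<open>Cut regularity\<close>

definition dens :: "'a set \<Rightarrow> ('a \<Rightarrow> 'a \<Rightarrow> real) \<Rightarrow> ('a \<Rightarrow> 'l) \<Rightarrow> 'a \<Rightarrow> 'a \<Rightarrow> real" where
  "dens V a Q x y = avg (V \<times> V) (map_prod Q Q) (case_prod a) (x, y)"

abbreviation kenergy :: "'a set \<Rightarrow> ('a \<Rightarrow> 'a \<Rightarrow> real) \<Rightarrow> ('a \<Rightarrow> 'l) \<Rightarrow> real" where
  "kenergy V a Q \<equiv> energy (V \<times> V) (map_prod Q Q) (case_prod a)"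

text \<open>One-sided closeness in cut norm: on no rectangle does \<open>a\<close> fall below its
  averages by more than \<zeta>. This is the direction that lower bounds for walk counts
  use.\<close>

definition cut_regular :: "'a set \<Rightarrow> ('a \<Rightarrow> 'a \<Rightarrow> real) \<Rightarrow> ('a \<Rightarrow> 'l) \<Rightarrow> real \<Rightarrow> bool" where
  "cut_regular V a Q \<zeta> \<longleftrightarrow>
     (\<forall>S\<subseteq>V. \<forall>T\<subseteq>V. (\<Sum>x\<in>S. \<Sum>y\<in>T. dens V a Q x y - a x y) \<le> \<zeta>)"

lemma refines_map_prod:
  assumes "refines V R Q"
  shows "refines (V \<times> V) (map_prod R R) (map_prod Q Q)"
  unfolding refines_def
proof (intro ballI impI)
  fix u v assume "u \<in> V \<times> V" "v \<in> V \<times> V" "map_prod R R u = map_prod R R v"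
  then have "Q (fst u) = Q (fst v)" "Q (snd u) = Q (snd v)"
    using assms unfolding refines_def by (metis fst_map_prod mem_Times_iff, metis snd_map_prod mem_Times_iff)
  then show "map_prod Q Q u = map_prod Q Q v" by (simp add: prod_eq_iff)
qed

lemma fibre_map_prod: "fibre (V \<times> V) (map_prod Q Q) (x, y) = fibre V Q x \<times> fibre V Q y"
  by (auto simp: fibre_def)

lemma dens_eq:
  "dens V a Q x y = (\<Sum>u\<in>fibre V Q x. \<Sum>v\<in>fibre V Q y. a u v)
     / (card (fibre V Q x) * card (fibre V Q y))"
  by (simp add: dens_def avg_def fibre_map_prod card_cartesian_product sum.cartesian_product)

text \<open>Every part is cut by the two sets of a violated inequality. Their product becomes a
  union of cells of the new partition of pairs, so the energy increment applies to it.\<close>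

lemma cut_regular_refinement_step:
  fixes Q :: "'a \<Rightarrow> nat" and \<zeta> :: real
  assumes V: "finite V" and Q: "Q ` V \<subseteq> {..<k}" and "0 \<le> \<zeta>" and "\<not> cut_regular V a Q \<zeta>"
  shows "\<exists>Q'::'a \<Rightarrow> nat. Q' ` V \<subseteq> {..<k * 4} \<and> refines V Q' Q \<and>
           \<zeta>\<^sup>2 \<le> (real (card V))\<^sup>2 * (kenergy V a Q' - kenergy V a Q)"
proof -
  obtain S T where ST: "S \<subseteq> V" "T \<subseteq> V"
    and dev: "\<zeta> < (\<Sum>x\<in>S. \<Sum>y\<in>T. dens V a Q x y - a x y)"
    using assms(4) by (auto simp: cut_regular_def not_le)
  \<comment> \<open>The two membership bits form the last base-4 digit, so \<open>k\<close> labels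
    become at most \<open>k * 4\<close>.\<close>
  define Q' where "Q' = (\<lambda>x. 4 * Q x + (2 * of_bool (x \<in> S) + of_bool (x \<in> T)))"
  have *: "Q x = Q y \<and> (x \<in> S \<longleftrightarrow> y \<in> S) \<and> (x \<in> T \<longleftrightarrow> y \<in> T)" if "Q' x = Q' y" for x y
  proof -
    have 1: "Q' z div 4 = Q z" "Q' z mod 4 = 2 * of_bool (z \<in> S) + of_bool (z \<in> T)" for z
      unfolding Q'_def by (auto simp: of_bool_def)
    show ?thesis
      using that 1[of x] 1[of y] by (auto simp: of_bool_def split: if_splits)
  qed
  have "Q' x < k * 4" if "x \<in> V" for x
  proof -
    have "Q x < k" using Q that by auto
    moreover have "2 * of_bool (x \<in> S) + of_bool (x \<in> T) < (4::nat)" by (auto simp: of_bool_def)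
    ultimately show ?thesis unfolding Q'_def by linarith
  qed
  moreover have ref: "refines V Q' Q" unfolding refines_def using * by blast
  moreover have "\<zeta>\<^sup>2 \<le> real (card (V \<times> V)) * (kenergy V a Q' - kenergy V a Q)"
  proof (rule energy_increment[where X = "S \<times> T"])
    show "refines (V \<times> V) (map_prod Q' Q') (map_prod Q Q)" using ref by (rule refines_map_prod)
    show "\<zeta> < (\<Sum>u\<in>S \<times> T. avg (V \<times> V) (map_prod Q Q) (case_prod a) u - case_prod a u)"
      using dev unfolding dens_def by (simp add: sum.cartesian_product split_def)
    show "v \<in> S \<times> T" if "map_prod Q' Q' u = map_prod Q' Q' v" "u \<in> S \<times> T" for u v
      using that *[of "fst u" "fst v"] *[of "snd u" "snd v"] by (auto simp: map_prod_def split_def mem_Times_iff)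
  qed (use V ST \<open>0 \<le> \<zeta>\<close> in auto)
  ultimately show ?thesis
    by (intro exI[of _ Q']) (auto simp: card_cartesian_product power2_eq_square)
qed

text \<open>If regularity failed at each of \<open>N\<close> refinements, every one of them would
  add \<zeta>^2 over the square of \<open>card V\<close> to the energy, which would end above
  \<open>B\<close>. No partition met on the way has more than \<open>k * 4 ^ N\<close> labels, so
  \<open>bound\<close> covers them all.\<close>

lemma cut_regular_refinement:
  fixes Q :: "'a \<Rightarrow> nat" and \<zeta> B :: real
  assumes V: "finite V" and Q: "Q ` V \<subseteq> {..<k}" and "0 \<le> \<zeta>"
    and bound: "\<And>Q'::'a \<Rightarrow> nat. Q' ` V \<subseteq> {..<k * 4 ^ N} \<Longrightarrow> kenergy V a Q' \<le> B"
    and N: "(real (card V))\<^sup>2 * B < N * \<zeta>\<^sup>2"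
  shows "\<exists>Q'::'a \<Rightarrow> nat. Q' ` V \<subseteq> {..<k * 4 ^ N} \<and> refines V Q' Q \<and> cut_regular V a Q' \<zeta>"
proof (rule ccontr)
  assume neg: "\<not> ?thesis"
  have mono: "k * 4 ^ j \<le> k * 4 ^ N" if "j \<le> N" for j
    using that by (simp add: power_increasing)
  have "\<exists>Q'::'a \<Rightarrow> nat. Q' ` V \<subseteq> {..<k * 4 ^ j} \<and> refines V Q' Q \<and>
      j * \<zeta>\<^sup>2 \<le> (real (card V))\<^sup>2 * kenergy V a Q'" if "j \<le> N" for j
    using that
  proof (induction j)
    case 0
    have "0 \<le> kenergy V a Q" unfolding energy_def by (intro sum_nonneg) simp
    then show ?case using Q by (intro exI[of _ Q]) (simp add: refines_refl)
  next
    case (Suc j)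
    then obtain Q' :: "'a \<Rightarrow> nat" where Q': "Q' ` V \<subseteq> {..<k * 4 ^ j}" "refines V Q' Q"
      "j * \<zeta>\<^sup>2 \<le> (real (card V))\<^sup>2 * kenergy V a Q'"
      by auto
    have "\<not> cut_regular V a Q' \<zeta>"
      using neg Q' mono[of j] Suc.prems by (meson Suc_leD lessThan_subset_iff order_trans)
    from cut_regular_refinement_step[OF V Q'(1) \<open>0 \<le> \<zeta>\<close> this]
    obtain Q'' :: "'a \<Rightarrow> nat" where Q'': "Q'' ` V \<subseteq> {..<k * 4 ^ j * 4}" "refines V Q'' Q'"
      "\<zeta>\<^sup>2 \<le> (real (card V))\<^sup>2 * (kenergy V a Q'' - kenergy V a Q')"
      by blast
    have "refines V Q'' Q" using Q''(2) Q'(2) by (rule refines_trans)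
    moreover have "Suc j * \<zeta>\<^sup>2 \<le> (real (card V))\<^sup>2 * kenergy V a Q''"
      using Q''(3) Q'(3) by (simp add: algebra_simps)
    ultimately show ?case using Q''(1) by (intro exI[of _ Q'']) (simp add: algebra_simps)
  qed
  from this[of N] obtain Q' :: "'a \<Rightarrow> nat" where "Q' ` V \<subseteq> {..<k * 4 ^ N}"
    "N * \<zeta>\<^sup>2 \<le> (real (card V))\<^sup>2 * kenergy V a Q'"
    by auto
  moreover from this have "(real (card V))\<^sup>2 * kenergy V a Q' \<le> (real (card V))\<^sup>2 * B"
    by (intro mult_left_mono bound) auto
  ultimately show False using N by linarith
qed

text \<open>\<open>level N i\<close> bounds the number of parts of the \<open>i\<close>-th partition when a partition with \<open>m\<close> parts
  is refined \<open>N m\<close> times by two sets.\<close>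

fun level :: "(nat \<Rightarrow> nat) \<Rightarrow> nat \<Rightarrow> nat" where
  "level N 0 = 1"
| "level N (Suc i) = level N i * 4 ^ N (level N i)"

lemma level_pos: "0 < level N i"
  by (induction i) auto

lemma level_mono: "i \<le> j \<Longrightarrow> level N i \<le> level N j"
  by (rule lift_Suc_mono_le[of "level N"]) auto

text \<open>Refinements are made in rounds of two. If each of \<open>J\<close> rounds raised the
  energy by more than \<open>\<epsilon> * card V\<close>, it would exceed its upper bound
  \<open>2 * card V\<close>. In the round that fails to do so, each precision is set by the label
  bound of the preceding partition.\<close>

lemma strong_cut_regularity:
  fixes V :: "'a set" and \<eta> :: "nat \<Rightarrow> real" and \<epsilon> r :: real
  assumes V: "finite V" and V0: "V \<noteq> {}"
    and \<eta>: "\<And>m. 0 < \<eta> m" and N: "\<And>m. 2 < N m * (\<eta> m)\<^sup>2"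
    and J: "2 < J * \<epsilon>" and r: "0 \<le> r" "r\<^sup>2 = card V"
    and bound: "\<forall>Q::'a \<Rightarrow> nat. Q ` V \<subseteq> {..<level N (2 * J)} \<longrightarrow> kenergy V a Q \<le> 2 * card V"
  shows "\<exists>(P::'a \<Rightarrow> nat) (Q::'a \<Rightarrow> nat) (R::'a \<Rightarrow> nat) j. j < J \<and>
    P ` V \<subseteq> {..<level N (2 * j)} \<and> Q ` V \<subseteq> {..<level N (2 * j + 1)} \<and>
    refines V Q P \<and> refines V R Q \<and>
    cut_regular V a Q (\<eta> (level N (2 * j)) * r ^ 3) \<and>
    cut_regular V a R (\<eta> (level N (2 * j + 1)) * r ^ 3) \<and>
    kenergy V a R - kenergy V a P \<le> \<epsilon> * card V"
proof (rule ccontr)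
  assume neg: "\<not> ?thesis"
  have cV: "0 < card V" using V V0 by (simp add: card_gt_0_iff)
  have step: "\<exists>Q'::'a \<Rightarrow> nat. Q' ` V \<subseteq> {..<level N (Suc i)} \<and> refines V Q' Q \<and>
      cut_regular V a Q' (\<eta> (level N i) * r ^ 3)"
    if "Suc i \<le> 2 * J" "Q ` V \<subseteq> {..<level N i}" for i and Q :: "'a \<Rightarrow> nat"
    unfolding level.simps
  proof (rule cut_regular_refinement[OF V that(2)])
    show "0 \<le> \<eta> (level N i) * r ^ 3" using \<eta>[of "level N i"] r by simp
    show "kenergy V a Q' \<le> 2 * card V"
      if "Q' ` V \<subseteq> {..<level N i * 4 ^ N (level N i)}" for Q' :: "'a \<Rightarrow> nat"
    proof (rule bound[rule_format])
      have "Q' ` V \<subseteq> {..<level N (Suc i)}" using that by simp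
      also have "\<dots> \<subseteq> {..<level N (2 * J)}" using level_mono[OF \<open>Suc i \<le> 2 * J\<close>] by simp
      finally show "Q' ` V \<subseteq> {..<level N (2 * J)}" .
    qed
    \<comment> \<open>As \<open>r\<close> is the square root of \<open>card V\<close>, the squared
      precision is \<eta>^2 times the cube of \<open>card V\<close>, and the condition for
      refinement becomes the assumption on \<open>N\<close>, whatever the size of
      \<open>V\<close>.\<close>
    have r6: "(r ^ 3)\<^sup>2 = real (card V) ^ 3"
      unfolding r(2)[symmetric] by (simp flip: power_mult)
    have "(real (card V))\<^sup>2 * real (2 * card V) = 2 * real (card V) ^ 3"
      by (simp add: power2_eq_square power3_eq_cube)
    also have "\<dots> < (N (level N i) * (\<eta> (level N i))\<^sup>2) * real (card V) ^ 3"
      using N cV by (intro mult_strict_right_mono) auto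
    also have "\<dots> = N (level N i) * (\<eta> (level N i) * r ^ 3)\<^sup>2"
      by (simp only: power_mult_distrib r6 mult.assoc)
    finally show "(real (card V))\<^sup>2 * real (2 * card V) < N (level N i) * (\<eta> (level N i) * r ^ 3)\<^sup>2" .
  qed
  have "\<exists>P::'a \<Rightarrow> nat. P ` V \<subseteq> {..<level N (2 * j)} \<and> j * (\<epsilon> * card V) \<le> kenergy V a P"
    if "j \<le> J" for j
    using that
  proof (induction j)
    case 0
    have "0 \<le> kenergy V a (\<lambda>_. 0::nat)" unfolding energy_def by (intro sum_nonneg) simp
    then show ?case by (intro exI[of _ "\<lambda>_. 0"]) auto
  next
    case (Suc j)
    then obtain P :: "'a \<Rightarrow> nat" where P: "P ` V \<subseteq> {..<level N (2 * j)}"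
      "j * (\<epsilon> * card V) \<le> kenergy V a P"
      by auto
    obtain Q :: "'a \<Rightarrow> nat" where Q: "Q ` V \<subseteq> {..<level N (2 * j + 1)}" "refines V Q P"
      "cut_regular V a Q (\<eta> (level N (2 * j)) * r ^ 3)"
      using step[OF _ P(1)] Suc.prems by auto
    obtain R :: "'a \<Rightarrow> nat" where R: "R ` V \<subseteq> {..<level N (2 * Suc j)}" "refines V R Q"
      "cut_regular V a R (\<eta> (level N (2 * j + 1)) * r ^ 3)"
      using step[OF _ Q(1)] Suc.prems by auto
    have "\<not> kenergy V a R - kenergy V a P \<le> \<epsilon> * card V"
      using neg P(1) Q R(2,3) Suc.prems by (meson Suc_le_lessD)
    then have "Suc j * (\<epsilon> * card V) \<le> kenergy V a R"
      using P(2) by (simp add: algebra_simps)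
    then show ?case using R(1) by blast
  qed
  from this[of J] obtain P :: "'a \<Rightarrow> nat" where "P ` V \<subseteq> {..<level N (2 * J)}"
    "J * (\<epsilon> * card V) \<le> kenergy V a P"
    by auto
  with bound[rule_format, of P] have "(J * \<epsilon>) * card V \<le> 2 * card V" by (simp add: mult.assoc)
  moreover have "2 * real (card V) < (J * \<epsilon>) * card V"
    using J cV by (intro mult_strict_right_mono) auto
  ultimately show False by simp
qed

section \<open>Two-step adjacency in graphs without 4-cycles\<close>

text \<open>A graph without 4-cycles and with degrees at most \<Delta>, as a 0/1 kernel. The absence
  of 4-cycles is stated through codegrees, the form in which the counts below use it.\<close>

locale c4_free_kernel =
  fixes V :: "'a set" and a :: "'a \<Rightarrow> 'a \<Rightarrow> real" and \<Delta> :: real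
  assumes finV: "finite V"
    and a01: "a x y = 0 \<or> a x y = 1"
    and a_sym: "a x y = a y x"
    and codegree_le: "x \<in> V \<Longrightarrow> y \<in> V \<Longrightarrow> x \<noteq> y \<Longrightarrow> (\<Sum>z\<in>V. a x z * a z y) \<le> 1"
    and degree_le: "x \<in> V \<Longrightarrow> (\<Sum>y\<in>V. a x y) \<le> \<Delta>"
    and \<Delta>_nonneg: "0 \<le> \<Delta>"
begin

lemma a_nonneg: "0 \<le> a x y"
  using a01[of x y] by auto

lemma a_le1: "a x y \<le> 1"
  using a01[of x y] by auto

lemma degree_subset_le:
  assumes "x \<in> V" "W \<subseteq> V"
  shows "(\<Sum>y\<in>W. a x y) \<le> \<Delta>"
  using sum_mono2[OF finV assms(2), of "a x"] degree_le[OF assms(1)] a_nonneg by force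

lemma sum_degree_subset_le:
  assumes "X \<subseteq> V" "Y \<subseteq> V"
  shows "(\<Sum>x\<in>X. \<Sum>y\<in>Y. a x y) \<le> card V * \<Delta>"
proof -
  have "(\<Sum>x\<in>X. \<Sum>y\<in>Y. a x y) \<le> (\<Sum>x\<in>X. \<Delta>)"
    using assms by (intro sum_mono degree_subset_le) auto
  also have "\<dots> \<le> card V * \<Delta>"
    using card_mono[OF finV assms(1)] \<Delta>_nonneg by (simp add: mult_right_mono)
  finally show ?thesis .
qed

text \<open>Expanding the square counts the common neighbours of pairs from \<open>C\<close>: a pair
  of distinct vertices has at most one, a diagonal pair at most \<Delta>.\<close>

lemma sum_square_degree_le:
  assumes "C \<subseteq> V"
  shows "(\<Sum>x\<in>V. (\<Sum>z\<in>C. a x z)\<^sup>2) \<le> (card C)\<^sup>2 + card C * \<Delta>"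
proof -
  have fC: "finite C" using assms finV finite_subset by blast
  have "(\<Sum>x\<in>V. (\<Sum>z\<in>C. a x z)\<^sup>2) = (\<Sum>x\<in>V. \<Sum>z\<in>C. \<Sum>w\<in>C. a z x * a x w)"
    by (simp add: power2_eq_square sum_product a_sym)
  also have "\<dots> = (\<Sum>z\<in>C. \<Sum>x\<in>V. \<Sum>w\<in>C. a z x * a x w)"
    by (rule sum.swap)
  also have "\<dots> = (\<Sum>z\<in>C. \<Sum>w\<in>C. \<Sum>x\<in>V. a z x * a x w)"
    by (intro sum.cong refl sum.swap)
  also have "\<dots> \<le> (\<Sum>z\<in>C. \<Sum>w\<in>C. 1 + (if w = z then \<Delta> else 0))"
  proof (intro sum_mono)
    fix z w assume zw: "z \<in> C" "w \<in> C"
    show "(\<Sum>x\<in>V. a z x * a x w) \<le> 1 + (if w = z then \<Delta> else 0)"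
    proof (cases "w = z")
      case True
      have "(\<Sum>x\<in>V. a z x * a x w) \<le> (\<Sum>x\<in>V. a z x)"
        using a_nonneg a_le1 by (intro sum_mono mult_left_le) auto
      then show ?thesis using True degree_le[of z] zw assms by force
    next
      case False
      then show ?thesis using codegree_le[of z w] zw assms by auto
    qed
  qed
  also have "\<dots> = (card C)\<^sup>2 + card C * \<Delta>"
    using fC by (simp add: sum.distrib power2_eq_square algebra_simps)
  finally show ?thesis .
qed

text \<open>Averaging only in the second variable gives a finer partition of the pairs, whose energy is a
  sum of codegrees.\<close>

lemma kenergy_le:
  fixes Q :: "'a \<Rightarrow> nat"
  assumes Q: "Q ` V \<subseteq> {..<k}"
  shows "kenergy V a Q \<le> card V + k * \<Delta>"
proof -
  define l where "l = (\<lambda>(x::'a, y). (x, Q y))"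
  have "refines (V \<times> V) l (map_prod Q Q)"
    unfolding refines_def l_def by auto
  then have "kenergy V a Q \<le> energy (V \<times> V) l (case_prod a)"
    using finV by (intro energy_mono) auto
  also have "\<dots> = (\<Sum>x\<in>V. \<Sum>y\<in>V. ((\<Sum>z\<in>fibre V Q y. a x z) / card (fibre V Q y))\<^sup>2)"
    unfolding energy_def sum.cartesian_product
  proof (intro sum.cong refl, clarsimp)
    fix x y assume "x \<in> V"
    then have "fibre (V \<times> V) l (x, y) = {x} \<times> fibre V Q y"
      by (auto simp: fibre_def l_def)
    moreover have "sum (case_prod a) ({x} \<times> fibre V Q y) = (\<Sum>z\<in>fibre V Q y. a x z)"
      by (simp add: sum.cartesian_product[symmetric])
    ultimately show "(avg (V \<times> V) l (case_prod a) (x, y))\<^sup>2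
        = ((\<Sum>z\<in>fibre V Q y. a x z) / card (fibre V Q y))\<^sup>2"
      by (simp add: avg_def card_cartesian_product)
  qed
  also have "\<dots> = (\<Sum>y\<in>V. (\<Sum>x\<in>V. (\<Sum>z\<in>fibre V Q y. a x z)\<^sup>2) / (card (fibre V Q y))\<^sup>2)"
    unfolding power_divide by (subst sum.swap) (simp add: sum_divide_distrib[where r = "_\<^sup>2"])
  also have "\<dots> \<le> (\<Sum>y\<in>V. 1 + \<Delta> * (1 / card (fibre V Q y)))"
  proof (intro sum_mono)
    fix y assume y: "y \<in> V"
    let ?c = "real (card (fibre V Q y))"
    have c: "0 < ?c" using y finV by (auto simp: fibre_def card_gt_0_iff)
    have "(\<Sum>x\<in>V. (\<Sum>z\<in>fibre V Q y. a x z)\<^sup>2) / ?c\<^sup>2 \<le> (?c\<^sup>2 + ?c * \<Delta>) / ?c\<^sup>2"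
      using sum_square_degree_le[of "fibre V Q y"] by (intro divide_right_mono) (auto simp: fibre_def)
    also have "\<dots> = 1 + \<Delta> * (1 / ?c)"
      using c by (simp add: field_simps power2_eq_square)
    finally show "(\<Sum>x\<in>V. (\<Sum>z\<in>fibre V Q y. a x z)\<^sup>2) / (card (fibre V Q y))\<^sup>2 \<le> 1 + \<Delta> * (1 / ?c)"
      by simp
  qed
  also have "\<dots> = card V + \<Delta> * (\<Sum>y\<in>V. 1 / card (fibre V Q y))"
    by (simp add: sum.distrib sum_distrib_left)
  \<comment> \<open>Reciprocal part sizes sum to one over each nonempty part, so \<Delta> is charged
    once per part and not once per vertex.\<close>
  also have "(\<Sum>y\<in>V. 1 / real (card (fibre V Q y))) = card (Q ` V)"
  proof -
    have "(\<Sum>y\<in>V. 1 / real (card (fibre V Q y)))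
        = (\<Sum>i\<in>Q ` V. \<Sum>y\<in>{y \<in> V. Q y = i}. 1 / real (card (fibre V Q y)))"
      using finV by (rule sum.image_gen)
    also have "\<dots> = (\<Sum>i\<in>Q ` V. 1)"
    proof (intro sum.cong refl)
      fix i assume "i \<in> Q ` V"
      then have "card {y \<in> V. Q y = i} \<noteq> 0" using finV by auto
      moreover have "(\<Sum>y\<in>{y \<in> V. Q y = i}. 1 / real (card (fibre V Q y)))
          = (\<Sum>y\<in>{y \<in> V. Q y = i}. 1 / real (card {y \<in> V. Q y = i}))"
        by (intro sum.cong refl) (auto simp: fibre_def)
      ultimately show "(\<Sum>y\<in>{y \<in> V. Q y = i}. 1 / real (card (fibre V Q y))) = 1" by simp
    qed
    finally show ?thesis by simp
  qed
  also have "card V + \<Delta> * card (Q ` V) \<le> card V + k * \<Delta>"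
  proof -
    have "card (Q ` V) \<le> k" using card_mono[OF _ Q] by simp
    then show ?thesis using \<Delta>_nonneg by (simp add: mult.commute[of _ \<Delta>] mult_left_mono)
  qed
  finally show ?thesis by simp
qed

definition paths :: "'a set \<Rightarrow> 'a \<Rightarrow> 'a \<Rightarrow> real" where
  "paths W x y = (\<Sum>z\<in>W. a x z * a z y)"

text \<open>The diagonal is removed because the codegree bound only concerns distinct vertices.\<close>

definition paths' :: "'a set \<Rightarrow> 'a \<Rightarrow> 'a \<Rightarrow> real" where
  "paths' W x y = (if x = y then 0 else paths W x y)"

lemma paths_nonneg: "0 \<le> paths W x y"
  unfolding paths_def by (intro sum_nonneg mult_nonneg_nonneg a_nonneg)

lemma paths'_le_paths: "paths' W x y \<le> paths W x y"
  unfolding paths'_def by (simp add: paths_nonneg)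

lemma paths_le:
  assumes "x \<in> V" "W \<subseteq> V"
  shows "paths W x y \<le> \<Delta>"
proof -
  have "paths W x y \<le> (\<Sum>z\<in>W. a x z)"
    unfolding paths_def using a_nonneg a_le1 by (intro sum_mono mult_left_le) auto
  then show ?thesis using degree_subset_le[OF assms] by linarith
qed

text \<open>Distinct vertices have at most one common neighbour, and a product of two entries is 0
  or 1, so the two-step count is itself an indicator. Two-step neighbourhoods can then serve as the
  sets in a cut norm bound.\<close>

lemma paths'_01:
  assumes "x \<in> V" "y \<in> V" "W \<subseteq> V"
  shows "paths' W x y = 0 \<or> paths' W x y = 1"
proof (cases "x = y")
  case False
  have "paths W x y \<le> (\<Sum>z\<in>V. a x z * a z y)"
    unfolding paths_def using finV assms(3) a_nonneg by (intro sum_mono2) auto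
  then have le: "paths W x y \<le> 1" using codegree_le[OF assms(1,2) False] by linarith
  have "paths W x y = 0 \<or> paths W x y = 1"
  proof (cases "\<forall>z\<in>W. a x z * a z y = 0")
    case True
    then have "paths W x y = 0" unfolding paths_def by (rule sum.neutral)
    then show ?thesis ..
  next
    case zero: False
    then obtain z where z: "z \<in> W" "a x z * a z y \<noteq> 0" by blast
    then have "a x z * a z y = 1" using a01[of x z] a01[of z y] by auto
    moreover have "a x z * a z y \<le> paths W x y"
      unfolding paths_def using z(1) finite_subset[OF assms(3) finV] a_nonneg
      by (intro member_le_sum) auto
    ultimately show ?thesis using le by linarith
  qed
  then show ?thesis using False by (simp add: paths'_def)
qed (simp add: paths'_def)

lemma paths'_nonneg: "0 \<le> paths' W x y"
  by (simp add: paths'_def paths_nonneg)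

lemma sum_paths_le:
  assumes "x \<in> V" "W \<subseteq> V" "Y \<subseteq> V"
  shows "(\<Sum>y\<in>Y. paths W x y) \<le> \<Delta>\<^sup>2"
proof -
  have "(\<Sum>y\<in>Y. paths W x y) = (\<Sum>z\<in>W. a x z * (\<Sum>y\<in>Y. a z y))"
    unfolding paths_def by (subst sum.swap) (simp add: sum_distrib_left)
  also have "\<dots> \<le> (\<Sum>z\<in>W. a x z * \<Delta>)"
    using assms a_nonneg degree_subset_le by (intro sum_mono mult_left_mono) auto
  also have "\<dots> = (\<Sum>z\<in>W. a x z) * \<Delta>" by (simp add: sum_distrib_right)
  also have "\<dots> \<le> \<Delta> * \<Delta>"
    using degree_subset_le[OF assms(1,2)] \<Delta>_nonneg by (intro mult_right_mono)
  finally show ?thesis by (simp add: power2_eq_square)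
qed

text \<open>On rectangles \<open>a\<close> dominates \<theta> times \<open>h\<close> up to the
  additive error \<zeta>. In the applications \<open>h\<close> is the 0/1 kernel that marks dense
  cells.\<close>

definition cut_above :: "('a \<Rightarrow> 'a \<Rightarrow> real) \<Rightarrow> real \<Rightarrow> real \<Rightarrow> bool" where
  "cut_above h \<theta> \<zeta> \<longleftrightarrow> (\<forall>S\<subseteq>V. \<forall>T\<subseteq>V.
     \<theta> * (\<Sum>x\<in>S. \<Sum>y\<in>T. h x y) - \<zeta> \<le> (\<Sum>x\<in>S. \<Sum>y\<in>T. a x y))"

text \<open>Weights with values 0 and 1 pick out a subset of each side, so the bound for sets
  applies directly.\<close>

lemma cut_above_weighted:
  fixes \<theta> \<zeta> :: real
  assumes h: "cut_above h \<theta> \<zeta>" and "X \<subseteq> V" "Y \<subseteq> V"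
    and u: "\<And>x. x \<in> X \<Longrightarrow> u x = 0 \<or> u x = 1" and v: "\<And>y. y \<in> Y \<Longrightarrow> v y = 0 \<or> v y = (1::real)"
  shows "\<theta> * (\<Sum>x\<in>X. \<Sum>y\<in>Y. h x y * (u x * v y)) - \<zeta> \<le> (\<Sum>x\<in>X. \<Sum>y\<in>Y. a x y * (u x * v y))"
proof -
  have fin: "finite X" "finite Y" using assms finV finite_subset by blast+
  have *: "(\<Sum>x\<in>X. \<Sum>y\<in>Y. f x y * (u x * v y)) = (\<Sum>x\<in>{x\<in>X. u x = 1}. \<Sum>y\<in>{y\<in>Y. v y = 1}. f x y)"
    for f :: "'a \<Rightarrow> 'a \<Rightarrow> real"
  proof -
    have "(\<Sum>y\<in>Y. f x y * v y) = (\<Sum>y\<in>{y\<in>Y. v y = 1}. f x y)" for x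
      using fin v by (intro sum.mono_neutral_cong_right) auto
    moreover have "(\<Sum>x\<in>X. g x * u x) = (\<Sum>x\<in>{x\<in>X. u x = 1}. g x)" for g
      using fin u by (intro sum.mono_neutral_cong_right) auto
    moreover have "(\<Sum>x\<in>X. \<Sum>y\<in>Y. f x y * (u x * v y)) = (\<Sum>x\<in>X. (\<Sum>y\<in>Y. f x y * v y) * u x)"
      by (simp add: sum_distrib_left mult_ac)
    ultimately show ?thesis by simp
  qed
  have "{x\<in>X. u x = 1} \<subseteq> V" "{y\<in>Y. v y = 1} \<subseteq> V" using assms by auto
  then show ?thesis using h unfolding * cut_above_def by blast
qed

text \<open>A nonnegative density dominates \<theta> times the indicator that it reaches \<theta>.
  Thresholding turns real densities into a 0/1 kernel, which can again serve as a weight.\<close>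

lemma cut_above_dens:
  fixes \<theta> \<zeta> :: real
  assumes "cut_regular V a Q \<zeta>" "0 \<le> \<theta>"
  shows "cut_above (\<lambda>x y. of_bool (\<theta> \<le> dens V a Q x y)) \<theta> \<zeta>"
  unfolding cut_above_def
proof (intro allI impI)
  fix S T assume ST: "S \<subseteq> V" "T \<subseteq> V"
  have d: "0 \<le> dens V a Q x y" for x y
    unfolding dens_eq by (intro divide_nonneg_nonneg sum_nonneg a_nonneg) auto
  have "\<theta> * (\<Sum>x\<in>S. \<Sum>y\<in>T. of_bool (\<theta> \<le> dens V a Q x y)) \<le> (\<Sum>x\<in>S. \<Sum>y\<in>T. dens V a Q x y)"
    unfolding sum_distrib_left using d by (intro sum_mono) (auto simp: of_bool_def)
  also have "\<dots> - \<zeta> \<le> (\<Sum>x\<in>S. \<Sum>y\<in>T. a x y)"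
    using assms(1) ST by (simp add: cut_regular_def sum_subtractf algebra_simps)
  finally show "\<theta> * (\<Sum>x\<in>S. \<Sum>y\<in>T. of_bool (\<theta> \<le> dens V a Q x y)) - \<zeta> \<le> (\<Sum>x\<in>S. \<Sum>y\<in>T. a x y)"
    by simp
qed

end

section \<open>Counting closed walks of length five\<close>

lemma sum5_permute:
  "(\<Sum>x1\<in>V1. \<Sum>x3\<in>V3. \<Sum>x4\<in>V4. \<Sum>x2\<in>V2. \<Sum>x5\<in>V5. F x1 x2 x3 x4 x5)
   = (\<Sum>x4\<in>V4. \<Sum>x5\<in>V5. \<Sum>x2\<in>V2. \<Sum>x3\<in>V3. \<Sum>x1\<in>V1. (F x1 x2 x3 x4 x5 :: real))"
  unfolding sum.cartesian_product
  by (rule sum.reindex_bij_witness[of _ "\<lambda>(x4, x5, x2, x3, x1). (x1, x3, x4, x2, x5)"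
        "\<lambda>(x1, x3, x4, x2, x5). (x4, x5, x2, x3, x1)"]) auto

lemma sum4_permute:
  "(\<Sum>x4\<in>V4. \<Sum>x5\<in>V5. \<Sum>x2\<in>V2. \<Sum>x3\<in>V3. F x2 x3 x4 x5)
   = (\<Sum>x2\<in>V2. \<Sum>x3\<in>V3. \<Sum>x4\<in>V4. \<Sum>x5\<in>V5. (F x2 x3 x4 x5 :: real))"
  unfolding sum.cartesian_product
  by (rule sum.reindex_bij_witness[of _ "\<lambda>(x2, x3, x4, x5). (x4, x5, x2, x3)"
        "\<lambda>(x4, x5, x2, x3). (x2, x3, x4, x5)"]) auto

context c4_free_kernel
begin

lemma sum_le_card_mult:
  fixes f :: "'a \<Rightarrow> real" and b :: real
  assumes "X \<subseteq> V" "0 \<le> b" "\<And>x. x \<in> X \<Longrightarrow> f x \<le> b"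
  shows "sum f X \<le> card V * b"
proof -
  have "sum f X \<le> card X * b" using sum_mono[of X f "\<lambda>_. b"] assms(3) by simp
  also have "\<dots> \<le> card V * b"
    using assms(2) card_mono[OF finV assms(1)] by (intro mult_right_mono) auto
  finally show ?thesis .
qed

text \<open>The next three lemmas replace the edges \<open>34\<close>, \<open>23\<close> and \<open>45\<close> of the pentagon in turn. Each time
  sparse edges are grouped into paths of length two, whose kernel is 0/1-valued off the diagonal, so
  that the cut norm bound on sets applies.\<close>

lemma cycle_walks_lower_bound_step1:
  fixes \<theta> \<zeta> :: real
  assumes h: "cut_above h \<theta> \<zeta>" and h01: "\<And>x y. h x y = 0 \<or> h x y = 1"
    and nonneg: "0 \<le> \<theta>" "0 \<le> \<zeta>"
    and sub: "V1 \<subseteq> V" "V2 \<subseteq> V" "V3 \<subseteq> V" "V4 \<subseteq> V" "V5 \<subseteq> V"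
  shows "\<theta> * (\<Sum>x1\<in>V1. \<Sum>x3\<in>V3. \<Sum>x4\<in>V4. h x3 x4 * (paths V2 x1 x3 * paths V5 x1 x4))
      - card V * \<zeta> - \<theta> * (card V * (2 * \<Delta> ^ 3))
    \<le> (\<Sum>x1\<in>V1. \<Sum>x3\<in>V3. \<Sum>x4\<in>V4. a x3 x4 * (paths V2 x1 x3 * paths V5 x1 x4))"
proof -
  have hb: "0 \<le> h x y" "h x y \<le> 1" for x y using h01[of x y] by auto
  have fin: "finite V3" "finite V4" using sub finV finite_subset by blast+
  have diag: "(\<Sum>x\<in>X. of_bool (x = y) * paths W y x) \<le> \<Delta>" if "y \<in> V" "W \<subseteq> V" "finite X" for X W y
  proof -
    have "(\<Sum>x\<in>X. of_bool (x = y) * paths W y x) = (\<Sum>x\<in>X. if x = y then paths W y x else 0)"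
      by (intro sum.cong) auto
    then show ?thesis using paths_le[OF that(1,2), of y] \<Delta>_nonneg that(3) by (simp add: sum.delta)
  qed
  have "\<theta> * (\<Sum>x3\<in>V3. \<Sum>x4\<in>V4. h x3 x4 * (paths V2 x1 x3 * paths V5 x1 x4)) - \<theta> * (2 * \<Delta> ^ 3) - \<zeta>
      \<le> (\<Sum>x3\<in>V3. \<Sum>x4\<in>V4. a x3 x4 * (paths V2 x1 x3 * paths V5 x1 x4))"
    if "x1 \<in> V1" for x1
  proof -
    have x1: "x1 \<in> V" using that sub by auto
    \<comment> \<open>Removing the diagonal from the two path kernels loses the terms with
      \<open>x3 = x1\<close> or \<open>x4 = x1\<close>; for given \<open>x1\<close> each family
      costs at most \<open>\<Delta> * \<Delta>\<^sup>2\<close>.\<close>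
    have "(\<Sum>x3\<in>V3. \<Sum>x4\<in>V4. h x3 x4 * (paths V2 x1 x3 * paths V5 x1 x4))
        \<le> (\<Sum>x3\<in>V3. \<Sum>x4\<in>V4. h x3 x4 * (paths' V2 x1 x3 * paths' V5 x1 x4)
            + (of_bool (x3 = x1) * paths V2 x1 x3) * paths V5 x1 x4
            + paths V2 x1 x3 * (of_bool (x4 = x1) * paths V5 x1 x4))"
    proof (intro sum_mono)
      fix x3 x4
      have pp: "0 \<le> paths V2 x1 x3 * paths V5 x1 x4" by (simp add: paths_nonneg)
      then have "h x3 x4 * (paths V2 x1 x3 * paths V5 x1 x4) \<le> paths V2 x1 x3 * paths V5 x1 x4"
        using hb[of x3 x4] by (simp add: mult_left_le_one_le)
      then show "h x3 x4 * (paths V2 x1 x3 * paths V5 x1 x4)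
        \<le> h x3 x4 * (paths' V2 x1 x3 * paths' V5 x1 x4)
            + (of_bool (x3 = x1) * paths V2 x1 x3) * paths V5 x1 x4
            + paths V2 x1 x3 * (of_bool (x4 = x1) * paths V5 x1 x4)"
        using pp by (auto simp: paths'_def)
    qed
    also have "\<dots> = (\<Sum>x3\<in>V3. \<Sum>x4\<in>V4. h x3 x4 * (paths' V2 x1 x3 * paths' V5 x1 x4))
        + (\<Sum>x3\<in>V3. of_bool (x3 = x1) * paths V2 x1 x3) * (\<Sum>x4\<in>V4. paths V5 x1 x4)
        + (\<Sum>x3\<in>V3. paths V2 x1 x3) * (\<Sum>x4\<in>V4. of_bool (x4 = x1) * paths V5 x1 x4)"
      by (simp only: sum.distrib sum_product)
    also have "\<dots> \<le> (\<Sum>x3\<in>V3. \<Sum>x4\<in>V4. h x3 x4 * (paths' V2 x1 x3 * paths' V5 x1 x4))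
        + \<Delta> * \<Delta>\<^sup>2 + \<Delta>\<^sup>2 * \<Delta>"
      using sub x1 fin \<Delta>_nonneg
      by (intro add_mono mult_mono diag sum_paths_le order_refl sum_nonneg mult_nonneg_nonneg paths_nonneg) auto
    finally have 1: "(\<Sum>x3\<in>V3. \<Sum>x4\<in>V4. h x3 x4 * (paths V2 x1 x3 * paths V5 x1 x4)) - 2 * \<Delta> ^ 3
        \<le> (\<Sum>x3\<in>V3. \<Sum>x4\<in>V4. h x3 x4 * (paths' V2 x1 x3 * paths' V5 x1 x4))"
      by (simp add: power2_eq_square power3_eq_cube)
    \<comment> \<open>For fixed \<open>x1\<close> the two path kernels are 0/1 weights, one in
      \<open>x3\<close> and one in \<open>x4\<close>, so the edge \<open>34\<close> can be
      replaced.\<close>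
    have "\<theta> * (\<Sum>x3\<in>V3. \<Sum>x4\<in>V4. h x3 x4 * (paths' V2 x1 x3 * paths' V5 x1 x4)) - \<zeta>
        \<le> (\<Sum>x3\<in>V3. \<Sum>x4\<in>V4. a x3 x4 * (paths' V2 x1 x3 * paths' V5 x1 x4))"
      using sub x1 by (intro cut_above_weighted[OF h] paths'_01) auto
    also have "\<dots> \<le> (\<Sum>x3\<in>V3. \<Sum>x4\<in>V4. a x3 x4 * (paths V2 x1 x3 * paths V5 x1 x4))"
      by (intro sum_mono mult_left_mono mult_mono paths'_le_paths paths_nonneg paths'_nonneg a_nonneg)
    finally show ?thesis
      using mult_left_mono[OF 1 nonneg(1)] by (simp add: right_diff_distrib)
  qed
  then have "(\<Sum>x1\<in>V1. \<theta> * (\<Sum>x3\<in>V3. \<Sum>x4\<in>V4. h x3 x4 * (paths V2 x1 x3 * paths V5 x1 x4)))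
      \<le> (\<Sum>x1\<in>V1. (\<Sum>x3\<in>V3. \<Sum>x4\<in>V4. a x3 x4 * (paths V2 x1 x3 * paths V5 x1 x4))
          + (\<theta> * (2 * \<Delta> ^ 3) + \<zeta>))"
    by (intro sum_mono) (simp add: algebra_simps)
  also have "\<dots> \<le> (\<Sum>x1\<in>V1. \<Sum>x3\<in>V3. \<Sum>x4\<in>V4. a x3 x4 * (paths V2 x1 x3 * paths V5 x1 x4))
      + card V * (\<theta> * (2 * \<Delta> ^ 3) + \<zeta>)"
    unfolding sum.distrib
    using sum_le_card_mult[OF sub(1), of "\<theta> * (2 * \<Delta> ^ 3) + \<zeta>" "\<lambda>_. \<theta> * (2 * \<Delta> ^ 3) + \<zeta>"] nonneg \<Delta>_nonneg
    by (simp add: algebra_simps)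
  finally show ?thesis by (simp add: sum_distrib_left[symmetric] algebra_simps)
qed

lemma cycle_walks_lower_bound_step2:
  fixes \<theta> \<zeta> :: real
  assumes h: "cut_above h \<theta> \<zeta>" and h01: "\<And>x y. h x y = 0 \<or> h x y = 1" and "0 \<le> \<zeta>"
    and sub: "V1 \<subseteq> V" "V2 \<subseteq> V" "V3 \<subseteq> V" "V4 \<subseteq> V" "V5 \<subseteq> V"
  shows "\<theta> * (\<Sum>x2\<in>V2. \<Sum>x3\<in>V3. \<Sum>x4\<in>V4. \<Sum>x5\<in>V5. a x4 x5 * (h x2 x3 * (paths' V1 x2 x5 * h x3 x4)))
      - card V * \<Delta> * \<zeta>
    \<le> (\<Sum>x1\<in>V1. \<Sum>x3\<in>V3. \<Sum>x4\<in>V4. h x3 x4 * (paths V2 x1 x3 * paths V5 x1 x4))"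
proof -
  have hb: "0 \<le> h x y" for x y using h01[of x y] by auto
  \<comment> \<open>For fixed \<open>x4\<close> and \<open>x5\<close> the weights are the path
    kernel from \<open>x2\<close> to \<open>x5\<close> and \<open>h x3 x4\<close>. The error \<zeta>
    is then multiplied by the sum of \<open>a\<close> over \<open>V4\<close> and \<open>V5\<close>,
    at most \<open>card V * \<Delta>\<close>.\<close>
  have "(\<Sum>x4\<in>V4. \<Sum>x5\<in>V5. a x4 x5 * (\<theta> * (\<Sum>x2\<in>V2. \<Sum>x3\<in>V3. h x2 x3 * (paths' V1 x2 x5 * h x3 x4)) - \<zeta>))
      \<le> (\<Sum>x4\<in>V4. \<Sum>x5\<in>V5. a x4 x5 * (\<Sum>x2\<in>V2. \<Sum>x3\<in>V3. a x2 x3 * (paths' V1 x2 x5 * h x3 x4)))"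
    using sub h01 by (intro sum_mono mult_left_mono cut_above_weighted[OF h] paths'_01 a_nonneg) auto
  also have "\<dots> \<le> (\<Sum>x4\<in>V4. \<Sum>x5\<in>V5. a x4 x5 * (\<Sum>x2\<in>V2. \<Sum>x3\<in>V3. a x2 x3 * (paths V1 x2 x5 * h x3 x4)))"
    using hb by (intro sum_mono mult_left_mono mult_right_mono paths'_le_paths a_nonneg)
  \<comment> \<open>With the paths through \<open>V1\<close> unfolded, the edges \<open>12\<close>,
    \<open>23\<close>, \<open>15\<close> and \<open>45\<close> regroup into two paths starting at
    \<open>x1\<close>.\<close>
  also have "\<dots> = (\<Sum>x4\<in>V4. \<Sum>x5\<in>V5. \<Sum>x2\<in>V2. \<Sum>x3\<in>V3. \<Sum>x1\<in>V1.
      h x3 x4 * (a x1 x2 * a x2 x3 * (a x1 x5 * a x5 x4)))"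
    unfolding paths_def sum_distrib_left sum_distrib_right
    by (intro sum.cong refl) (simp add: a_sym mult_ac)
  also have "\<dots> = (\<Sum>x1\<in>V1. \<Sum>x3\<in>V3. \<Sum>x4\<in>V4. \<Sum>x2\<in>V2. \<Sum>x5\<in>V5.
      h x3 x4 * (a x1 x2 * a x2 x3 * (a x1 x5 * a x5 x4)))"
    by (rule sum5_permute[symmetric])
  also have "\<dots> = (\<Sum>x1\<in>V1. \<Sum>x3\<in>V3. \<Sum>x4\<in>V4. h x3 x4 * (paths V2 x1 x3 * paths V5 x1 x4))"
    unfolding paths_def sum_product unfolding sum_distrib_left ..
  finally have 1: "(\<Sum>x4\<in>V4. \<Sum>x5\<in>V5. a x4 x5 * (\<theta> * (\<Sum>x2\<in>V2. \<Sum>x3\<in>V3. h x2 x3 * (paths' V1 x2 x5 * h x3 x4)) - \<zeta>))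
     \<le> (\<Sum>x1\<in>V1. \<Sum>x3\<in>V3. \<Sum>x4\<in>V4. h x3 x4 * (paths V2 x1 x3 * paths V5 x1 x4))" .
  have "(\<Sum>x4\<in>V4. \<Sum>x5\<in>V5. a x4 x5 * (\<theta> * (\<Sum>x2\<in>V2. \<Sum>x3\<in>V3. h x2 x3 * (paths' V1 x2 x5 * h x3 x4)) - \<zeta>))
     = \<theta> * (\<Sum>x4\<in>V4. \<Sum>x5\<in>V5. \<Sum>x2\<in>V2. \<Sum>x3\<in>V3. a x4 x5 * (h x2 x3 * (paths' V1 x2 x5 * h x3 x4)))
       - (\<Sum>x4\<in>V4. \<Sum>x5\<in>V5. a x4 x5) * \<zeta>"
    by (simp add: right_diff_distrib sum_subtractf sum_distrib_left sum_distrib_right mult_ac)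
  moreover have "(\<Sum>x4\<in>V4. \<Sum>x5\<in>V5. a x4 x5) * \<zeta> \<le> card V * \<Delta> * \<zeta>"
    using sum_degree_subset_le[OF sub(4,5)] \<open>0 \<le> \<zeta>\<close> by (intro mult_right_mono) auto
  moreover have "\<theta> * (\<Sum>x4\<in>V4. \<Sum>x5\<in>V5. \<Sum>x2\<in>V2. \<Sum>x3\<in>V3. a x4 x5 * (h x2 x3 * (paths' V1 x2 x5 * h x3 x4)))
     = \<theta> * (\<Sum>x2\<in>V2. \<Sum>x3\<in>V3. \<Sum>x4\<in>V4. \<Sum>x5\<in>V5. a x4 x5 * (h x2 x3 * (paths' V1 x2 x5 * h x3 x4)))"
    by (rule arg_cong[OF sum4_permute])
  ultimately show ?thesis using 1 by linarith
qed

lemma cycle_walks_lower_bound_step3: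
  fixes \<theta> \<zeta> :: real
  assumes h: "cut_above h \<theta> \<zeta>" and h01: "\<And>x y. h x y = 0 \<or> h x y = 1" and "0 \<le> \<theta>" "0 \<le> \<zeta>"
    and sub: "V1 \<subseteq> V" "V2 \<subseteq> V" "V3 \<subseteq> V" "V4 \<subseteq> V" "V5 \<subseteq> V"
  shows "\<theta> * (\<Sum>x2\<in>V2. \<Sum>x3\<in>V3. \<Sum>x4\<in>V4. \<Sum>x5\<in>V5. h x2 x3 * h x3 x4 * h x4 x5 * paths V1 x2 x5)
      - \<theta> * (card V ^ 3 * \<Delta>) - card V ^ 2 * \<zeta>
    \<le> (\<Sum>x2\<in>V2. \<Sum>x3\<in>V3. \<Sum>x4\<in>V4. \<Sum>x5\<in>V5. a x4 x5 * (h x2 x3 * (paths' V1 x2 x5 * h x3 x4)))"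
proof -
  have hb: "0 \<le> h x y" "h x y \<le> 1" for x y using h01[of x y] by auto
  have fin: "finite V5" using sub finV finite_subset by blast
  \<comment> \<open>For fixed \<open>x2\<close> and \<open>x3\<close> the edge \<open>45\<close>
    carries the weight \<open>h x2 x3 * h x3 x4\<close> at \<open>x4\<close> and the path kernel
    through \<open>V1\<close> at \<open>x5\<close>. The diagonal \<open>x5 = x2\<close> costs at
    most \<Delta> for each \<open>x4\<close>.\<close>
  have 1: "\<theta> * (\<Sum>x4\<in>V4. \<Sum>x5\<in>V5. h x2 x3 * h x3 x4 * h x4 x5 * paths V1 x2 x5)
      - (\<theta> * (card V * \<Delta>) + \<zeta>)
    \<le> (\<Sum>x4\<in>V4. \<Sum>x5\<in>V5. a x4 x5 * (h x2 x3 * (paths' V1 x2 x5 * h x3 x4)))"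
    if "x2 \<in> V2" "x3 \<in> V3" for x2 x3
  proof -
    have x2: "x2 \<in> V" using that sub by auto
    have "(\<Sum>x4\<in>V4. \<Sum>x5\<in>V5. h x2 x3 * h x3 x4 * h x4 x5 * paths V1 x2 x5)
       \<le> (\<Sum>x4\<in>V4. \<Sum>x5\<in>V5. h x4 x5 * ((h x2 x3 * h x3 x4) * paths' V1 x2 x5) + (if x5 = x2 then \<Delta> else 0))"
    proof (intro sum_mono)
      fix x4 x5
      have "h x2 x3 * h x3 x4 * h x4 x5 * paths V1 x2 x5 \<le> 1 * \<Delta>"
        using hb x2 sub paths_le paths_nonneg by (intro mult_mono mult_le_one) auto
      then show "h x2 x3 * h x3 x4 * h x4 x5 * paths V1 x2 x5
          \<le> h x4 x5 * ((h x2 x3 * h x3 x4) * paths' V1 x2 x5) + (if x5 = x2 then \<Delta> else 0)"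
        by (auto simp: paths'_def mult_ac)
    qed
    also have "\<dots> \<le> (\<Sum>x4\<in>V4. \<Sum>x5\<in>V5. h x4 x5 * ((h x2 x3 * h x3 x4) * paths' V1 x2 x5)) + card V * \<Delta>"
      unfolding sum.distrib using fin \<Delta>_nonneg
      by (intro add_left_mono sum_le_card_mult[OF sub(4)]) (auto simp: sum.delta)
    finally have 2: "(\<Sum>x4\<in>V4. \<Sum>x5\<in>V5. h x2 x3 * h x3 x4 * h x4 x5 * paths V1 x2 x5) - card V * \<Delta>
       \<le> (\<Sum>x4\<in>V4. \<Sum>x5\<in>V5. h x4 x5 * ((h x2 x3 * h x3 x4) * paths' V1 x2 x5))" by simp
    have "\<theta> * (\<Sum>x4\<in>V4. \<Sum>x5\<in>V5. h x4 x5 * ((h x2 x3 * h x3 x4) * paths' V1 x2 x5)) - \<zeta>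
      \<le> (\<Sum>x4\<in>V4. \<Sum>x5\<in>V5. a x4 x5 * ((h x2 x3 * h x3 x4) * paths' V1 x2 x5))"
    proof (rule cut_above_weighted[OF h sub(4,5)])
      show "h x2 x3 * h x3 x4 = 0 \<or> h x2 x3 * h x3 x4 = 1" for x4
        using h01[of x2 x3] h01[of x3 x4] by auto
      show "paths' V1 x2 x5 = 0 \<or> paths' V1 x2 x5 = 1" if "x5 \<in> V5" for x5
        using x2 sub that by (intro paths'_01) auto
    qed
    also have "\<dots> = (\<Sum>x4\<in>V4. \<Sum>x5\<in>V5. a x4 x5 * (h x2 x3 * (paths' V1 x2 x5 * h x3 x4)))"
      by (simp add: mult_ac)
    finally show ?thesis
      using mult_left_mono[OF 2 \<open>0 \<le> \<theta>\<close>] by (simp add: right_diff_distrib)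
  qed
  define e where "e = \<theta> * (card V * \<Delta>) + \<zeta>"
  have e: "0 \<le> e" unfolding e_def using \<Delta>_nonneg \<open>0 \<le> \<theta>\<close> \<open>0 \<le> \<zeta>\<close> by simp
  have "(\<Sum>x2\<in>V2. \<Sum>x3\<in>V3. \<theta> * (\<Sum>x4\<in>V4. \<Sum>x5\<in>V5. h x2 x3 * h x3 x4 * h x4 x5 * paths V1 x2 x5))
    \<le> (\<Sum>x2\<in>V2. \<Sum>x3\<in>V3. (\<Sum>x4\<in>V4. \<Sum>x5\<in>V5. a x4 x5 * (h x2 x3 * (paths' V1 x2 x5 * h x3 x4))) + e)"
    using 1 unfolding e_def by (intro sum_mono) (simp add: algebra_simps)
  also have "\<dots> \<le> (\<Sum>x2\<in>V2. \<Sum>x3\<in>V3. \<Sum>x4\<in>V4. \<Sum>x5\<in>V5. a x4 x5 * (h x2 x3 * (paths' V1 x2 x5 * h x3 x4)))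
      + card V * (card V * e)"
    unfolding sum.distrib using e
    by (intro add_left_mono sum_le_card_mult[OF sub(2)] sum_le_card_mult[OF sub(3)]) auto
  finally show ?thesis
    by (simp add: e_def sum_distrib_left[symmetric] algebra_simps power2_eq_square power3_eq_cube)
qed

text \<open>The three replacements are chained, the second multiplied by \<theta> and the third by
  \<theta>^2, and their errors carry these factors. Still sparse are the edges \<open>12\<close> and
  \<open>15\<close>, present as paths through \<open>V1\<close>.\<close>

lemma cycle_walks_lower_bound:
  fixes \<theta> \<zeta> :: real
  assumes h: "cut_above h \<theta> \<zeta>" and h01: "\<And>x y. h x y = 0 \<or> h x y = 1"
    and nonneg: "0 \<le> \<theta>" "0 \<le> \<zeta>"
    and sub: "V1 \<subseteq> V" "V2 \<subseteq> V" "V3 \<subseteq> V" "V4 \<subseteq> V" "V5 \<subseteq> V"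
  shows "\<theta> ^ 3 * (\<Sum>x2\<in>V2. \<Sum>x3\<in>V3. \<Sum>x4\<in>V4. \<Sum>x5\<in>V5. h x2 x3 * h x3 x4 * h x4 x5 * paths V1 x2 x5)
      - (card V * \<zeta> + 2 * \<theta> * card V * \<Delta> ^ 3 + \<theta> * card V * \<Delta> * \<zeta> + \<theta>\<^sup>2 * (card V)\<^sup>2 * \<zeta>
         + \<theta> ^ 3 * card V ^ 3 * \<Delta>)
    \<le> (\<Sum>x1\<in>V1. \<Sum>x3\<in>V3. \<Sum>x4\<in>V4. a x3 x4 * (paths V2 x1 x3 * paths V5 x1 x4))"
proof -
  note 1 = cycle_walks_lower_bound_step1[OF assms]
  note 2 = mult_left_mono[OF cycle_walks_lower_bound_step2[OF h h01 nonneg(2) sub] nonneg(1)]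
  note 3 = mult_left_mono[OF cycle_walks_lower_bound_step3[OF assms], of "\<theta>\<^sup>2"]
  show ?thesis using 1 2 3 nonneg
    by (simp add: algebra_simps power2_eq_square power3_eq_cube)
qed

end

section \<open>Two-step walks weighted by the labels of their ends\<close>

lemma mult_lower_bound:
  fixes u v g h :: real
  assumes "0 \<le> u" "0 \<le> v" "0 \<le> g" "0 \<le> h"
  shows "g * h - max 0 (g - u) * h - g * max 0 (h - v) \<le> u * v"
proof (cases "u \<le> g")
  case True
  show ?thesis
  proof (cases "v \<le> h")
    case True
    \<comment> \<open>If both factors fall short, the two sides differ by exactly this product of
      the shortfalls.\<close>
    have "0 \<le> (g - u) * (h - v)" using \<open>u \<le> g\<close> True by simp
    then show ?thesis using True \<open>u \<le> g\<close> by (simp add: max_def algebra_simps)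
  next
    case False
    then have "u * h \<le> u * v" using assms by (intro mult_left_mono) auto
    then show ?thesis using False True by (simp add: max_def algebra_simps)
  qed
next
  case False
  have "g * min h v \<le> u * v" using False assms by (intro mult_mono) auto
  then show ?thesis using False by (auto simp: max_def min_def algebra_simps split: if_splits)
qed

lemma sum_by_labels:
  fixes Q :: "'a \<Rightarrow> nat" and w :: "nat \<Rightarrow> nat \<Rightarrow> real"
  assumes "finite X" "finite Y" "Q ` X \<subseteq> {..<k}" "Q ` Y \<subseteq> {..<k}"
  shows "(\<Sum>x\<in>X. \<Sum>y\<in>Y. w (Q x) (Q y) * G x y)
    = (\<Sum>i<k. \<Sum>j<k. w i j * (\<Sum>x\<in>{x\<in>X. Q x = i}. \<Sum>y\<in>{y\<in>Y. Q y = j}. G x y))"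
proof -
  have grp: "(\<Sum>i<k. \<Sum>x\<in>{x\<in>A. Q x = i}. F x) = sum F A"
    if "finite A" "Q ` A \<subseteq> {..<k}" for A and F :: "'a \<Rightarrow> real"
    using that by (intro sum.group) auto
  have "(\<Sum>x\<in>X. \<Sum>y\<in>Y. w (Q x) (Q y) * G x y)
      = (\<Sum>i<k. \<Sum>x\<in>{x\<in>X. Q x = i}. \<Sum>j<k. \<Sum>y\<in>{y\<in>Y. Q y = j}. w (Q x) (Q y) * G x y)"
    unfolding grp[OF assms(2,4)] grp[OF assms(1,3)] ..
  also have "\<dots> = (\<Sum>i<k. \<Sum>x\<in>{x\<in>X. Q x = i}. \<Sum>j<k. w i j * (\<Sum>y\<in>{y\<in>Y. Q y = j}. G x y))"
    unfolding sum_distrib_left by (intro sum.cong refl) auto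
  also have "\<dots> = (\<Sum>i<k. \<Sum>j<k. \<Sum>x\<in>{x\<in>X. Q x = i}. w i j * (\<Sum>y\<in>{y\<in>Y. Q y = j}. G x y))"
    by (intro sum.cong refl sum.swap)
  finally show ?thesis by (simp only: sum_distrib_left)
qed

context c4_free_kernel
begin

text \<open>Grouped by the middle vertex, the count is a sum of products of two degrees. Each is
  compared with \<theta> times the degree in \<open>h\<close>, which is at most
  \<open>\<theta> * card V\<close>, so a total shortfall of \<zeta> on either side costs at most
  \<open>\<theta> * card V * \<zeta>\<close>.\<close>

lemma cherries_lower_bound:
  fixes \<theta> \<zeta> :: real
  assumes h: "cut_above h \<theta> \<zeta>" and h01: "\<And>x y. h x y = 0 \<or> h x y = 1" and nonneg: "0 \<le> \<theta>" "0 \<le> \<zeta>"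
    and sub: "X \<subseteq> V" "Y \<subseteq> V" "Z \<subseteq> V"
  shows "\<theta>\<^sup>2 * (\<Sum>x\<in>X. (\<Sum>y\<in>Y. h x y) * (\<Sum>z\<in>Z. h x z)) - 2 * (\<theta> * card V * \<zeta>)
    \<le> (\<Sum>x\<in>X. (\<Sum>y\<in>Y. a x y) * (\<Sum>z\<in>Z. a x z))"
proof -
  have hb: "0 \<le> h x y" "h x y \<le> 1" for x y using h01[of x y] by auto
  have fX: "finite X" using sub finV finite_subset by blast
  let ?D = "\<lambda>W x. \<Sum>y\<in>W. a x y" and ?g = "\<lambda>W x. \<theta> * (\<Sum>y\<in>W. h x y)"
  have g: "0 \<le> ?g W x" "?g W x \<le> \<theta> * card V" if "W \<subseteq> V" for W x
    using nonneg hb sum_le_card_mult[OF that, of 1 "h x"]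
    by (auto intro!: mult_nonneg_nonneg sum_nonneg mult_left_mono)
  have D: "0 \<le> ?D W x" for W x using a_nonneg by (simp add: sum_nonneg)
  have err: "(\<Sum>x\<in>X. max 0 (?g W x - ?D W x)) \<le> \<zeta>" if "W \<subseteq> V" for W
  proof -
    \<comment> \<open>Testing the cut bound on the deficient vertices alone controls the total
      shortfall, not merely a signed sum.\<close>
    let ?S = "{x \<in> X. ?D W x < ?g W x}"
    have "(\<Sum>x\<in>X. max 0 (?g W x - ?D W x)) = (\<Sum>x\<in>?S. ?g W x - ?D W x)"
      using fX by (intro sum.mono_neutral_cong_right) auto
    also have "\<dots> = \<theta> * (\<Sum>x\<in>?S. \<Sum>y\<in>W. h x y) - (\<Sum>x\<in>?S. \<Sum>y\<in>W. a x y)"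
      by (simp add: sum_subtractf sum_distrib_left)
    also have "\<dots> \<le> \<zeta>"
    proof -
      have "?S \<subseteq> V" using sub by auto
      then have "\<theta> * (\<Sum>x\<in>?S. \<Sum>y\<in>W. h x y) - \<zeta> \<le> (\<Sum>x\<in>?S. \<Sum>y\<in>W. a x y)"
        using h that unfolding cut_above_def by blast
      then show ?thesis by linarith
    qed
    finally show ?thesis .
  qed
  have "(\<Sum>x\<in>X. ?g Y x * ?g Z x)
      \<le> (\<Sum>x\<in>X. ?D Y x * ?D Z x + max 0 (?g Y x - ?D Y x) * (\<theta> * card V)
            + (\<theta> * card V) * max 0 (?g Z x - ?D Z x))"
  proof (intro sum_mono)
    fix x
    have "?g Y x * ?g Z x - max 0 (?g Y x - ?D Y x) * ?g Z x - ?g Y x * max 0 (?g Z x - ?D Z x) \<le> ?D Y x * ?D Z x"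
      using g sub D by (intro mult_lower_bound) auto
    moreover have "max 0 (?g Y x - ?D Y x) * ?g Z x \<le> max 0 (?g Y x - ?D Y x) * (\<theta> * card V)"
      by (rule mult_left_mono[OF g(2)[OF sub(3)]]) simp
    moreover have "?g Y x * max 0 (?g Z x - ?D Z x) \<le> (\<theta> * card V) * max 0 (?g Z x - ?D Z x)"
      by (rule mult_right_mono[OF g(2)[OF sub(2)]]) simp
    ultimately show "?g Y x * ?g Z x \<le> ?D Y x * ?D Z x + max 0 (?g Y x - ?D Y x) * (\<theta> * card V)
            + (\<theta> * card V) * max 0 (?g Z x - ?D Z x)"
      by linarith
  qed
  also have "\<dots> = (\<Sum>x\<in>X. ?D Y x * ?D Z x) + (\<Sum>x\<in>X. max 0 (?g Y x - ?D Y x)) * (\<theta> * card V)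
      + (\<theta> * card V) * (\<Sum>x\<in>X. max 0 (?g Z x - ?D Z x))"
    by (simp only: sum.distrib sum_distrib_left sum_distrib_right)
  also have "\<dots> \<le> (\<Sum>x\<in>X. ?D Y x * ?D Z x) + \<zeta> * (\<theta> * card V) + (\<theta> * card V) * \<zeta>"
    by (intro add_mono order_refl mult_left_mono[OF err[OF sub(3)]] mult_right_mono[OF err[OF sub(2)]])
      (simp_all add: nonneg)
  finally show ?thesis
    by (simp add: sum_distrib_left power2_eq_square algebra_simps)
qed

text \<open>The weight depends only on labels, so the unweighted bound can be applied to each of the
  \<open>k\<^sup>2\<close> pairs of cells. This factor is why the precision of \<open>h\<close> has
  to be chosen after the number of labels of \<open>Q\<close>.\<close>

lemma weighted_cherries_lower_bound:
  fixes \<theta> \<zeta> :: real and Q :: "'a \<Rightarrow> nat"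
  assumes h: "cut_above h \<theta> \<zeta>" and h01: "\<And>x y. h x y = 0 \<or> h x y = 1" and nonneg: "0 \<le> \<theta>" "0 \<le> \<zeta>"
    and sub: "X \<subseteq> V" "Y \<subseteq> V" "Z \<subseteq> V" and Q: "Q ` V \<subseteq> {..<k}"
    and w: "\<And>i j. 0 \<le> w i j" "\<And>i j. w i j \<le> m"
  shows "\<theta>\<^sup>2 * (\<Sum>y\<in>Y. \<Sum>z\<in>Z. w (Q y) (Q z) * (\<Sum>x\<in>X. h x y * h x z)) - 2 * (k\<^sup>2 * m * \<theta> * card V * \<zeta>)
    \<le> (\<Sum>y\<in>Y. \<Sum>z\<in>Z. w (Q y) (Q z) * paths X y z)"
proof -
  have fin: "finite Y" "finite Z" and QY: "Q ` Y \<subseteq> {..<k}" and QZ: "Q ` Z \<subseteq> {..<k}"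
    using sub Q finV finite_subset by blast+
  have swap: "(\<Sum>y\<in>A. \<Sum>z\<in>B. \<Sum>x\<in>X. f x y * f x z) = (\<Sum>x\<in>X. (\<Sum>y\<in>A. f x y) * (\<Sum>z\<in>B. f x z))"
    for A B and f :: "'a \<Rightarrow> 'a \<Rightarrow> real"
  proof -
    have "(\<Sum>y\<in>A. \<Sum>z\<in>B. \<Sum>x\<in>X. f x y * f x z) = (\<Sum>y\<in>A. \<Sum>x\<in>X. \<Sum>z\<in>B. f x y * f x z)"
      by (intro sum.cong refl sum.swap)
    also have "\<dots> = (\<Sum>x\<in>X. \<Sum>y\<in>A. \<Sum>z\<in>B. f x y * f x z)" by (rule sum.swap)
    finally show ?thesis by (simp only: sum_product)
  qed
  define Yi where "Yi = (\<lambda>i. {y\<in>Y. Q y = i})"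
  define Zj where "Zj = (\<lambda>j. {z\<in>Z. Q z = j})"
  define e where "e = 2 * (\<theta> * card V * \<zeta>)"
  have e: "0 \<le> e" using nonneg by (simp add: e_def)
  have m: "0 \<le> m" using w[of 0 0] by linarith
  have dist: "\<theta>\<^sup>2 * (\<Sum>i<k. \<Sum>j<k. w i j * S i j) = (\<Sum>i<k. \<Sum>j<k. w i j * (\<theta>\<^sup>2 * S i j))"
    for S :: "nat \<Rightarrow> nat \<Rightarrow> real"
    by (simp add: sum_distrib_left mult_ac)
  have "\<theta>\<^sup>2 * (\<Sum>y\<in>Y. \<Sum>z\<in>Z. w (Q y) (Q z) * (\<Sum>x\<in>X. h x y * h x z))
      = (\<Sum>i<k. \<Sum>j<k. w i j * (\<theta>\<^sup>2 * (\<Sum>x\<in>X. (\<Sum>y\<in>Yi i. h x y) * (\<Sum>z\<in>Zj j. h x z))))"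
    unfolding sum_by_labels[OF fin QY QZ, of w] swap Yi_def Zj_def by (rule dist)
  also have "\<dots> \<le> (\<Sum>i<k. \<Sum>j<k. w i j * (\<Sum>x\<in>X. (\<Sum>y\<in>Yi i. a x y) * (\<Sum>z\<in>Zj j. a x z)) + m * e)"
  proof (intro sum_mono)
    fix i j
    have "\<theta>\<^sup>2 * (\<Sum>x\<in>X. (\<Sum>y\<in>Yi i. h x y) * (\<Sum>z\<in>Zj j. h x z))
        \<le> (\<Sum>x\<in>X. (\<Sum>y\<in>Yi i. a x y) * (\<Sum>z\<in>Zj j. a x z)) + e"
      using cherries_lower_bound[OF h h01 nonneg sub(1), of "Yi i" "Zj j"] sub(2,3)
      by (force simp: Yi_def Zj_def e_def)
    then have "w i j * (\<theta>\<^sup>2 * (\<Sum>x\<in>X. (\<Sum>y\<in>Yi i. h x y) * (\<Sum>z\<in>Zj j. h x z)))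
        \<le> w i j * (\<Sum>x\<in>X. (\<Sum>y\<in>Yi i. a x y) * (\<Sum>z\<in>Zj j. a x z)) + w i j * e"
      using w(1)[of i j] mult_left_mono by (fastforce simp flip: distrib_left)
    also have "w i j * e \<le> m * e" using w(2) e by (rule mult_right_mono)
    finally show "w i j * (\<theta>\<^sup>2 * (\<Sum>x\<in>X. (\<Sum>y\<in>Yi i. h x y) * (\<Sum>z\<in>Zj j. h x z)))
        \<le> w i j * (\<Sum>x\<in>X. (\<Sum>y\<in>Yi i. a x y) * (\<Sum>z\<in>Zj j. a x z)) + m * e"
      by simp
  qed
  also have "\<dots> = (\<Sum>y\<in>Y. \<Sum>z\<in>Z. w (Q y) (Q z) * (\<Sum>x\<in>X. a x y * a x z)) + k\<^sup>2 * (m * e)"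
    unfolding sum_by_labels[OF fin QY QZ, of w] swap Yi_def Zj_def
    by (simp add: sum.distrib power2_eq_square mult_ac)
  also have "(\<Sum>y\<in>Y. \<Sum>z\<in>Z. w (Q y) (Q z) * (\<Sum>x\<in>X. a x y * a x z))
      = (\<Sum>y\<in>Y. \<Sum>z\<in>Z. w (Q y) (Q z) * paths X y z)"
    unfolding paths_def by (intro sum.cong refl arg_cong2[where f = "(*)"]) (simp add: a_sym)
  finally show ?thesis by (simp add: e_def algebra_simps)
qed

end

text \<open>Missing pairs of each of the five kinds spoil at most a tenth of the tuples, hence at
  most half altogether. The right side is arranged as a weight on \<open>x2\<close> and
  \<open>x5\<close> times the cherries with centre \<open>x1\<close>.\<close>

lemma pentagon_union_bound:
  fixes h h' :: "'a \<Rightarrow> 'a \<Rightarrow> real"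
  assumes h01: "\<And>x y. h x y = 0 \<or> h x y = 1" and h'01: "\<And>x y. h' x y = 0 \<or> h' x y = 1"
    and b12: "(\<Sum>x\<in>V1. \<Sum>y\<in>V2. 1 - h' x y) \<le> card V1 * card V2 / 10"
    and b23: "(\<Sum>x\<in>V2. \<Sum>y\<in>V3. 1 - h x y) \<le> card V2 * card V3 / 10"
    and b34: "(\<Sum>x\<in>V3. \<Sum>y\<in>V4. 1 - h x y) \<le> card V3 * card V4 / 10"
    and b45: "(\<Sum>x\<in>V4. \<Sum>y\<in>V5. 1 - h x y) \<le> card V4 * card V5 / 10"
    and b15: "(\<Sum>x\<in>V1. \<Sum>y\<in>V5. 1 - h' x y) \<le> card V1 * card V5 / 10"
  shows "real (card V1) * card V2 * card V3 * card V4 * card V5 / 2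
    \<le> (\<Sum>x2\<in>V2. \<Sum>x5\<in>V5. (\<Sum>x3\<in>V3. \<Sum>x4\<in>V4. h x2 x3 * h x3 x4 * h x4 x5) * (\<Sum>x1\<in>V1. h' x1 x2 * h' x1 x5))"
proof -
  let ?c1 = "real (card V1)" and ?c2 = "real (card V2)" and ?c3 = "real (card V3)"
    and ?c4 = "real (card V4)" and ?c5 = "real (card V5)"
  \<comment> \<open>A product of 0/1 values is at least one minus the number of zeros among
    them.\<close>
  have pt: "1 - (1 - h' x1 x2) - (1 - h x2 x3) - (1 - h x3 x4) - (1 - h x4 x5) - (1 - h' x1 x5)
      \<le> h x2 x3 * h x3 x4 * h x4 x5 * (h' x1 x2 * h' x1 x5)" for x1 x2 x3 x4 x5
    using h01[of x2 x3] h01[of x3 x4] h01[of x4 x5] h'01[of x1 x2] h'01[of x1 x5] by (elim disjE) simp_all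
  have "(\<Sum>x1\<in>V1. \<Sum>x2\<in>V2. \<Sum>x3\<in>V3. \<Sum>x4\<in>V4. \<Sum>x5\<in>V5.
        1 - (1 - h' x1 x2) - (1 - h x2 x3) - (1 - h x3 x4) - (1 - h x4 x5) - (1 - h' x1 x5))
      \<le> (\<Sum>x1\<in>V1. \<Sum>x2\<in>V2. \<Sum>x3\<in>V3. \<Sum>x4\<in>V4. \<Sum>x5\<in>V5.
        h x2 x3 * h x3 x4 * h x4 x5 * (h' x1 x2 * h' x1 x5))"
    by (intro sum_mono pt)
  also have "\<dots> = (\<Sum>x2\<in>V2. \<Sum>x5\<in>V5. \<Sum>x3\<in>V3. \<Sum>x4\<in>V4. \<Sum>x1\<in>V1.
        h x2 x3 * h x3 x4 * h x4 x5 * (h' x1 x2 * h' x1 x5))"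
    unfolding sum.cartesian_product
    by (rule sum.reindex_bij_witness[of _ "\<lambda>(x2, x5, x3, x4, x1). (x1, x2, x3, x4, x5)"
        "\<lambda>(x1, x2, x3, x4, x5). (x2, x5, x3, x4, x1)"]) auto
  also have "\<dots> = (\<Sum>x2\<in>V2. \<Sum>x5\<in>V5. (\<Sum>x3\<in>V3. \<Sum>x4\<in>V4. h x2 x3 * h x3 x4 * h x4 x5) * (\<Sum>x1\<in>V1. h' x1 x2 * h' x1 x5))"
    unfolding sum_distrib_right unfolding sum_distrib_left ..
  finally have 1: "(\<Sum>x1\<in>V1. \<Sum>x2\<in>V2. \<Sum>x3\<in>V3. \<Sum>x4\<in>V4. \<Sum>x5\<in>V5.
        1 - (1 - h' x1 x2) - (1 - h x2 x3) - (1 - h x3 x4) - (1 - h x4 x5) - (1 - h' x1 x5))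
     \<le> (\<Sum>x2\<in>V2. \<Sum>x5\<in>V5. (\<Sum>x3\<in>V3. \<Sum>x4\<in>V4. h x2 x3 * h x3 x4 * h x4 x5) * (\<Sum>x1\<in>V1. h' x1 x2 * h' x1 x5))" .
  define B12 where "B12 = (\<lambda>x y. 1 - h' x y)"
  define B where "B = (\<lambda>x y. 1 - h x y)"
  have "(\<Sum>x1\<in>V1. \<Sum>x2\<in>V2. \<Sum>x3\<in>V3. \<Sum>x4\<in>V4. \<Sum>x5\<in>V5.
        1 - B12 x1 x2 - B x2 x3 - B x3 x4 - B x4 x5 - B12 x1 x5)
     = ?c1 * ?c2 * ?c3 * ?c4 * ?c5
       - ?c3 * ?c4 * ?c5 * (\<Sum>x\<in>V1. \<Sum>y\<in>V2. B12 x y)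
       - ?c1 * ?c4 * ?c5 * (\<Sum>x\<in>V2. \<Sum>y\<in>V3. B x y)
       - ?c1 * ?c2 * ?c5 * (\<Sum>x\<in>V3. \<Sum>y\<in>V4. B x y)
       - ?c1 * ?c2 * ?c3 * (\<Sum>x\<in>V4. \<Sum>y\<in>V5. B x y)
       - ?c2 * ?c3 * ?c4 * (\<Sum>x\<in>V1. \<Sum>y\<in>V5. B12 x y)"
    by (simp add: sum_subtractf sum_distrib_left[symmetric] sum_distrib_right[symmetric] mult_ac)
      (simp add: algebra_simps)
  moreover have "?c3 * ?c4 * ?c5 * (\<Sum>x\<in>V1. \<Sum>y\<in>V2. B12 x y) \<le> ?c3 * ?c4 * ?c5 * (?c1 * ?c2 / 10)"
    using b12 unfolding B12_def by (intro mult_left_mono) auto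
  moreover have "?c1 * ?c4 * ?c5 * (\<Sum>x\<in>V2. \<Sum>y\<in>V3. B x y) \<le> ?c1 * ?c4 * ?c5 * (?c2 * ?c3 / 10)"
    using b23 unfolding B_def by (intro mult_left_mono) auto
  moreover have "?c1 * ?c2 * ?c5 * (\<Sum>x\<in>V3. \<Sum>y\<in>V4. B x y) \<le> ?c1 * ?c2 * ?c5 * (?c3 * ?c4 / 10)"
    using b34 unfolding B_def by (intro mult_left_mono) auto
  moreover have "?c1 * ?c2 * ?c3 * (\<Sum>x\<in>V4. \<Sum>y\<in>V5. B x y) \<le> ?c1 * ?c2 * ?c3 * (?c4 * ?c5 / 10)"
    using b45 unfolding B_def by (intro mult_left_mono) auto
  moreover have "?c2 * ?c3 * ?c4 * (\<Sum>x\<in>V1. \<Sum>y\<in>V5. B12 x y) \<le> ?c2 * ?c3 * ?c4 * (?c1 * ?c5 / 10)"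
    using b15 unfolding B12_def by (intro mult_left_mono) auto
  ultimately have "?c1 * ?c2 * ?c3 * ?c4 * ?c5 / 2 \<le> (\<Sum>x1\<in>V1. \<Sum>x2\<in>V2. \<Sum>x3\<in>V3. \<Sum>x4\<in>V4. \<Sum>x5\<in>V5.
        1 - B12 x1 x2 - B x2 x3 - B x3 x4 - B x4 x5 - B12 x1 x5)"
    by (simp add: algebra_simps)
  then show ?thesis using 1 unfolding B12_def B_def by linarith
qed

context c4_free_kernel
begin

text \<open>The edges \<open>34\<close>, \<open>23\<close> and \<open>45\<close> are handled by the
  kernel on labels of \<open>Q\<close>, the edges \<open>12\<close> and \<open>15\<close> by the
  second kernel \<open>h'\<close>. Each of the five edges yields one factor \<theta>.\<close>

lemma cycle_walks_lower_bound_labels: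
  fixes \<theta> \<zeta> \<zeta>' :: real and Q :: "'a \<Rightarrow> nat"
  assumes h: "cut_above (\<lambda>x y. hl (Q x) (Q y)) \<theta> \<zeta>" and h01: "\<And>i j. hl i j = 0 \<or> hl i j = 1"
    and h': "cut_above h' \<theta> \<zeta>'" and h'01: "\<And>x y. h' x y = 0 \<or> h' x y = 1"
    and nonneg: "0 \<le> \<theta>" "0 \<le> \<zeta>" "0 \<le> \<zeta>'" and Q: "Q ` V \<subseteq> {..<k}"
    and sub: "V1 \<subseteq> V" "V2 \<subseteq> V" "V3 \<subseteq> V" "V4 \<subseteq> V" "V5 \<subseteq> V"
    and b12: "(\<Sum>x\<in>V1. \<Sum>y\<in>V2. 1 - h' x y) \<le> card V1 * card V2 / 10"
    and b23: "(\<Sum>x\<in>V2. \<Sum>y\<in>V3. 1 - hl (Q x) (Q y)) \<le> card V2 * card V3 / 10"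
    and b34: "(\<Sum>x\<in>V3. \<Sum>y\<in>V4. 1 - hl (Q x) (Q y)) \<le> card V3 * card V4 / 10"
    and b45: "(\<Sum>x\<in>V4. \<Sum>y\<in>V5. 1 - hl (Q x) (Q y)) \<le> card V4 * card V5 / 10"
    and b15: "(\<Sum>x\<in>V1. \<Sum>y\<in>V5. 1 - h' x y) \<le> card V1 * card V5 / 10"
  shows "\<theta> ^ 5 * (real (card V1) * card V2 * card V3 * card V4 * card V5 / 2)
      - (2 * \<theta> ^ 4 * k\<^sup>2 * card V ^ 3 * \<zeta>' + card V * \<zeta> + 2 * \<theta> * card V * \<Delta> ^ 3
         + \<theta> * card V * \<Delta> * \<zeta> + \<theta>\<^sup>2 * (card V)\<^sup>2 * \<zeta> + \<theta> ^ 3 * card V ^ 3 * \<Delta>)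
    \<le> (\<Sum>x1\<in>V1. \<Sum>x3\<in>V3. \<Sum>x4\<in>V4. a x3 x4 * (paths V2 x1 x3 * paths V5 x1 x4))"
proof -
  let ?h = "\<lambda>x y. hl (Q x) (Q y)"
  \<comment> \<open>Once three edges are dense, the weight left on \<open>x2\<close> and
    \<open>x5\<close> depends only on their labels, because \<open>hl\<close> does.\<close>
  define w where "w = (\<lambda>i j. \<Sum>x3\<in>V3. \<Sum>x4\<in>V4. hl i (Q x3) * hl (Q x3) (Q x4) * hl (Q x4) j)"
  have hb: "0 \<le> hl i j" "hl i j \<le> 1" for i j using h01[of i j] by auto
  have w0: "0 \<le> w i j" for i j unfolding w_def using hb by (intro sum_nonneg mult_nonneg_nonneg) auto
  have w1: "w i j \<le> real (card V) * (real (card V) * 1)" for i j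
    unfolding w_def using hb
    by (intro sum_le_card_mult[OF sub(3)] sum_le_card_mult[OF sub(4)] mult_le_one mult_nonneg_nonneg) auto
  have eq: "(\<Sum>x2\<in>V2. \<Sum>x3\<in>V3. \<Sum>x4\<in>V4. \<Sum>x5\<in>V5. ?h x2 x3 * ?h x3 x4 * ?h x4 x5 * paths V1 x2 x5)
      = (\<Sum>x2\<in>V2. \<Sum>x5\<in>V5. w (Q x2) (Q x5) * paths V1 x2 x5)"
    unfolding w_def sum_distrib_right
    unfolding sum.cartesian_product
    by (rule sum.reindex_bij_witness[of _ "\<lambda>(x2, x5, x3, x4). (x2, x3, x4, x5)"
        "\<lambda>(x2, x3, x4, x5). (x2, x5, x3, x4)"]) auto
  have 1: "\<theta> ^ 3 * (\<Sum>x2\<in>V2. \<Sum>x5\<in>V5. w (Q x2) (Q x5) * paths V1 x2 x5)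
      - (card V * \<zeta> + 2 * \<theta> * card V * \<Delta> ^ 3 + \<theta> * card V * \<Delta> * \<zeta> + \<theta>\<^sup>2 * (card V)\<^sup>2 * \<zeta>
         + \<theta> ^ 3 * card V ^ 3 * \<Delta>)
    \<le> (\<Sum>x1\<in>V1. \<Sum>x3\<in>V3. \<Sum>x4\<in>V4. a x3 x4 * (paths V2 x1 x3 * paths V5 x1 x4))"
    using cycle_walks_lower_bound[OF h h01 nonneg(1,2) sub] unfolding eq .
  have 2: "\<theta>\<^sup>2 * (\<Sum>x2\<in>V2. \<Sum>x5\<in>V5. w (Q x2) (Q x5) * (\<Sum>x1\<in>V1. h' x1 x2 * h' x1 x5))
      - 2 * (k\<^sup>2 * (real (card V) * (real (card V) * 1)) * \<theta> * card V * \<zeta>')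
    \<le> (\<Sum>x2\<in>V2. \<Sum>x5\<in>V5. w (Q x2) (Q x5) * paths V1 x2 x5)"
    using weighted_cherries_lower_bound[OF h' h'01 nonneg(1,3) sub(1,2,5) Q w0 w1] by simp
  have 3: "real (card V1) * card V2 * card V3 * card V4 * card V5 / 2
      \<le> (\<Sum>x2\<in>V2. \<Sum>x5\<in>V5. w (Q x2) (Q x5) * (\<Sum>x1\<in>V1. h' x1 x2 * h' x1 x5))"
    unfolding w_def by (rule pentagon_union_bound[OF h01 h'01 b12 b23 b34 b45 b15])
  have "\<theta> ^ 5 * (real (card V1) * card V2 * card V3 * card V4 * card V5 / 2)
      \<le> \<theta> ^ 3 * (\<theta>\<^sup>2 * (\<Sum>x2\<in>V2. \<Sum>x5\<in>V5. w (Q x2) (Q x5) * (\<Sum>x1\<in>V1. h' x1 x2 * h' x1 x5)))"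
    using mult_left_mono[OF 3, of "\<theta> ^ 5"] nonneg by (simp add: mult.assoc[symmetric] flip: power_add)
  also have "\<dots> \<le> \<theta> ^ 3 * ((\<Sum>x2\<in>V2. \<Sum>x5\<in>V5. w (Q x2) (Q x5) * paths V1 x2 x5)
      + 2 * (k\<^sup>2 * (real (card V) * (real (card V) * 1)) * \<theta> * card V * \<zeta>'))"
    using 2 nonneg by (intro mult_left_mono) auto
  also have "\<dots> = \<theta> ^ 3 * (\<Sum>x2\<in>V2. \<Sum>x5\<in>V5. w (Q x2) (Q x5) * paths V1 x2 x5)
      + 2 * \<theta> ^ 4 * k\<^sup>2 * card V ^ 3 * \<zeta>'"
    by (simp add: algebra_simps power2_eq_square power3_eq_cube power4_eq_xxxx)
  finally show ?thesis using 1 unfolding of_nat_power by linarith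
qed

end

section \<open>Deleting the edges of irregular pairs\<close>

text \<open>At the points in question the coarse average is at least 2 * \<theta>, while on over a
  tenth of the fibre the fine average is below \<theta>, less than half of the coarse one. There the
  squared difference is at least a quarter of the squared coarse average, and the sum of squared
  differences is the energy gap.\<close>

lemma sum_irregular_le_energy_diff:
  fixes \<theta> :: real
  assumes U: "finite U" and ref: "refines U m l" and \<theta>: "0 < \<theta>"
  shows "(\<Sum>u\<in>U. f u * of_bool (2 * \<theta> \<le> avg U l f u \<and> 1 / 10 < avg U l (\<lambda>v. of_bool (avg U m f v < \<theta>)) u))
    \<le> 20 / \<theta> * (energy U m f - energy U l f)"
proof -
  define b where "b = (\<lambda>v. of_bool (avg U m f v < \<theta>) :: real)"
  define X where "X = (\<lambda>u. of_bool (2 * \<theta> \<le> avg U l f u \<and> 1 / 10 < avg U l b u) :: real)"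
  have X_cong: "X v = X u" if "l v = l u" for u v
    unfolding X_def avg_cong[where l = l, OF that] ..
  have "(\<Sum>u\<in>U. f u * X u) = (\<Sum>u\<in>U. avg U l f u * X u)"
    by (rule sum_avg_mult[where l = l, OF U, symmetric]) (rule X_cong)
  \<comment> \<open>The factor is 10, which offsets the fraction \<open>avg U l b u\<close>, times 1
    / (2 * \<theta>), which offsets one factor of the coarse average.\<close>
  also have "\<dots> \<le> (\<Sum>u\<in>U. 5 / \<theta> * (avg U l b u * ((avg U l f u)\<^sup>2 * X u)))"
  proof (intro sum_mono)
    fix u
    show "avg U l f u * X u \<le> 5 / \<theta> * (avg U l b u * ((avg U l f u)\<^sup>2 * X u))"
    proof (cases "2 * \<theta> \<le> avg U l f u \<and> 1 / 10 < avg U l b u")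
      case True
      then have "avg U l f u * \<theta> \<le> avg U l f u * (avg U l f u / 2)"
        using \<theta> by (intro mult_left_mono) auto
      also have "\<dots> = 5 * (1 / 10) * (avg U l f u)\<^sup>2" by (simp add: power2_eq_square)
      also have "\<dots> \<le> 5 * avg U l b u * (avg U l f u)\<^sup>2"
        using True by (intro mult_right_mono) auto
      finally show ?thesis using True \<theta> by (simp add: X_def field_simps)
    qed (auto simp: X_def)
  qed
  also have "\<dots> = 5 / \<theta> * (\<Sum>u\<in>U. avg U l b u * ((avg U l f u)\<^sup>2 * X u))"
    by (simp add: sum_distrib_left)
  \<comment> \<open>The other factors are constant on coarse fibres, so the fraction can be replaced
    by the indicator \<open>b\<close> itself.\<close>
  also have "(\<Sum>u\<in>U. avg U l b u * ((avg U l f u)\<^sup>2 * X u)) = (\<Sum>u\<in>U. b u * ((avg U l f u)\<^sup>2 * X u))"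
  proof (rule sum_avg_mult[OF U])
    fix u v assume "l v = l u"
    then show "(avg U l f v)\<^sup>2 * X v = (avg U l f u)\<^sup>2 * X u"
      using X_cong[of v u] avg_cong[of l v u U f] by simp
  qed
  also have "\<dots> \<le> (\<Sum>u\<in>U. 4 * (avg U m f u - avg U l f u)\<^sup>2)"
  proof (intro sum_mono)
    fix u
    show "b u * ((avg U l f u)\<^sup>2 * X u) \<le> 4 * (avg U m f u - avg U l f u)\<^sup>2"
    proof (cases "avg U m f u < \<theta> \<and> 2 * \<theta> \<le> avg U l f u")
      case True
      then have "(avg U l f u)\<^sup>2 \<le> (2 * (avg U l f u - avg U m f u))\<^sup>2"
        using \<theta> by (intro power_mono) auto
      moreover have "b u * ((avg U l f u)\<^sup>2 * X u) \<le> (avg U l f u)\<^sup>2"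
        by (simp add: b_def X_def)
      moreover have "(2 * (avg U l f u - avg U m f u))\<^sup>2 = 4 * (avg U m f u - avg U l f u)\<^sup>2"
        by (simp add: power2_eq_square algebra_simps)
      ultimately show ?thesis by linarith
    qed (auto simp: b_def X_def)
  qed
  also have "\<dots> = 4 * (energy U m f - energy U l f)"
    by (simp add: energy_diff[OF U ref] sum_distrib_left)
  finally show ?thesis using \<theta> unfolding X_def b_def by (simp add: field_simps)
qed

lemma card_small_fibres_le:
  fixes P :: "'a \<Rightarrow> nat" and s :: real
  assumes "finite V" "P ` V \<subseteq> {..<M}" "0 \<le> s"
  shows "real (card {x \<in> V. card (fibre V P x) < s}) \<le> M * s"
proof -
  let ?S = "{x \<in> V. real (card (fibre V P x)) < s}"
  have "real (card ?S) = (\<Sum>i<M. \<Sum>x\<in>{x \<in> ?S. P x = i}. 1)"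
    using assms by (subst sum.group) auto
  also have "\<dots> \<le> (\<Sum>i<M. s)"
  proof (intro sum_mono)
    fix i
    show "(\<Sum>x\<in>{x \<in> ?S. P x = i}. 1) \<le> s"
    proof (cases "{x \<in> ?S. P x = i} = {}")
      case True
      then show ?thesis using \<open>0 \<le> s\<close> by (simp only: sum.empty)
    next
      case False
      then obtain y where y: "y \<in> V" "card (fibre V P y) < s" "P y = i" by blast
      have "card {x \<in> ?S. P x = i} \<le> card (fibre V P y)"
        using y assms by (intro card_mono) (auto simp: fibre_def)
      then show ?thesis using y by simp
    qed
  qed
  finally show ?thesis by simp
qed

context c4_free_kernel
begin

text \<open>The tenth is a fifth of one half: five conditions of this kind enter one union
  bound.\<close>

definition few_sparse :: "('a \<Rightarrow> nat) \<Rightarrow> ('a \<Rightarrow> nat) \<Rightarrow> real \<Rightarrow> 'a \<Rightarrow> 'a \<Rightarrow> bool" where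
  "few_sparse P Q \<theta> x y \<longleftrightarrow>
     (\<Sum>u\<in>fibre V P x. \<Sum>v\<in>fibre V P y. 1 - of_bool (\<theta> \<le> dens V a Q u v))
       \<le> card (fibre V P x) * card (fibre V P y) / 10"

text \<open>The edge relation of the reduced graph. The density required for \<open>P\<close> is
  twice the threshold for \<open>Q\<close> and \<open>R\<close>; this gap turns a failure of
  \<open>few_sparse\<close> into a gain of energy.\<close>

definition good :: "('a \<Rightarrow> nat) \<Rightarrow> ('a \<Rightarrow> nat) \<Rightarrow> ('a \<Rightarrow> nat) \<Rightarrow> real \<Rightarrow> real \<Rightarrow> 'a \<Rightarrow> 'a \<Rightarrow> bool" where
  "good P Q R \<theta> s x y \<longleftrightarrow> s \<le> card (fibre V P x) \<and> s \<le> card (fibre V P y) \<and>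
     2 * \<theta> \<le> dens V a P x y \<and> few_sparse P Q \<theta> x y \<and> few_sparse P R \<theta> x y"

text \<open>An instance of the bound on irregular points for the product labelling of pairs: when
  \<open>few_sparse\<close> fails, the indicator of low \<open>Q\<close>-density has average above a
  tenth on the cell.\<close>

lemma sum_not_few_sparse_le:
  fixes P Q :: "'a \<Rightarrow> nat" and \<theta> :: real
  assumes ref: "refines V Q P" and \<theta>: "0 < \<theta>"
  shows "(\<Sum>x\<in>V. \<Sum>y\<in>V. a x y * of_bool (2 * \<theta> \<le> dens V a P x y \<and> \<not> few_sparse P Q \<theta> x y))
    \<le> 20 / \<theta> * (kenergy V a Q - kenergy V a P)"
proof -
  let ?U = "V \<times> V" and ?l = "map_prod P P" and ?m = "map_prod Q Q" and ?f = "case_prod a"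
  have fU: "finite ?U" using finV by simp
  have "(\<Sum>x\<in>V. \<Sum>y\<in>V. a x y * of_bool (2 * \<theta> \<le> dens V a P x y \<and> \<not> few_sparse P Q \<theta> x y))
     = (\<Sum>u\<in>?U. ?f u * of_bool (2 * \<theta> \<le> avg ?U ?l ?f u \<and>
          1 / 10 < avg ?U ?l (\<lambda>v. of_bool (avg ?U ?m ?f v < \<theta>)) u))"
    unfolding sum.cartesian_product
  proof (intro sum.cong refl, clarify)
    fix x y assume xy: "x \<in> V" "y \<in> V"
    have pos: "0 < real (card (fibre V P x)) * real (card (fibre V P y))"
    proof -
      have "card (fibre V P z) > 0" if "z \<in> V" for z
        using that finV by (auto simp: fibre_def card_gt_0_iff)
      then show ?thesis using xy by simp
    qed
    have "avg ?U ?l (\<lambda>v. of_bool (avg ?U ?m ?f v < \<theta>)) (x, y)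
        = (\<Sum>u\<in>fibre V P x. \<Sum>v\<in>fibre V P y. 1 - of_bool (\<theta> \<le> dens V a Q u v))
          / (card (fibre V P x) * card (fibre V P y))"
      unfolding avg_def[of ?U ?l] fibre_map_prod card_cartesian_product dens_def
      unfolding sum.cartesian_product of_nat_mult
      by (intro arg_cong2[where f = "(/)"] sum.cong refl) (auto simp: of_bool_def)
    then have "few_sparse P Q \<theta> x y \<longleftrightarrow> \<not> 1 / 10 < avg ?U ?l (\<lambda>v. of_bool (avg ?U ?m ?f v < \<theta>)) (x, y)"
      using pos by (simp add: few_sparse_def not_less field_simps)
    then show "a x y * of_bool (2 * \<theta> \<le> dens V a P x y \<and> \<not> few_sparse P Q \<theta> x y)
      = a x y * of_bool (2 * \<theta> \<le> avg ?U ?l ?f (x, y) \<and>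
          1 / 10 < avg ?U ?l (\<lambda>v. of_bool (avg ?U ?m ?f v < \<theta>)) (x, y))"
      by (simp add: dens_def)
  qed
  also have "\<dots> \<le> 20 / \<theta> * (kenergy V a Q - kenergy V a P)"
    using fU refines_map_prod[OF ref] \<theta> by (rule sum_irregular_le_energy_diff)
  finally show ?thesis .
qed

text \<open>A pair that is not good has an end in a small part, or low density for \<open>P\<close>,
  or too many sparse pairs for \<open>Q\<close> or for \<open>R\<close>. The summands bound these
  kinds in this order, the first counted once for each end.\<close>

lemma sum_not_good_le:
  fixes P Q R :: "'a \<Rightarrow> nat" and \<theta> s :: real
  assumes P: "P ` V \<subseteq> {..<M}" and ref: "refines V Q P" "refines V R P" and \<theta>: "0 < \<theta>" and s: "0 \<le> s"
  shows "(\<Sum>x\<in>V. \<Sum>y\<in>V. a x y * of_bool (\<not> good P Q R \<theta> s x y))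
    \<le> 2 * (M * s * \<Delta>) + 2 * \<theta> * (card V)\<^sup>2
      + 20 / \<theta> * (kenergy V a Q - kenergy V a P) + 20 / \<theta> * (kenergy V a R - kenergy V a P)"
proof -
  let ?sm = "\<lambda>x. of_bool (card (fibre V P x) < s) :: real"
  have "(\<Sum>x\<in>V. \<Sum>y\<in>V. a x y * of_bool (\<not> good P Q R \<theta> s x y))
    \<le> (\<Sum>x\<in>V. \<Sum>y\<in>V. ?sm x * a x y + ?sm y * a y x + a x y * of_bool (dens V a P x y < 2 * \<theta>)
        + a x y * of_bool (2 * \<theta> \<le> dens V a P x y \<and> \<not> few_sparse P Q \<theta> x y)
        + a x y * of_bool (2 * \<theta> \<le> dens V a P x y \<and> \<not> few_sparse P R \<theta> x y))"
    using a_nonneg a_sym by (intro sum_mono) (auto simp: good_def of_bool_def not_le)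
  also have "\<dots> = 2 * (\<Sum>x\<in>V. ?sm x * (\<Sum>y\<in>V. a x y))
      + (\<Sum>x\<in>V. \<Sum>y\<in>V. a x y * of_bool (dens V a P x y < 2 * \<theta>))
      + (\<Sum>x\<in>V. \<Sum>y\<in>V. a x y * of_bool (2 * \<theta> \<le> dens V a P x y \<and> \<not> few_sparse P Q \<theta> x y))
      + (\<Sum>x\<in>V. \<Sum>y\<in>V. a x y * of_bool (2 * \<theta> \<le> dens V a P x y \<and> \<not> few_sparse P R \<theta> x y))"
  proof -
    have "(\<Sum>x\<in>V. \<Sum>y\<in>V. ?sm y * a y x) = (\<Sum>x\<in>V. \<Sum>y\<in>V. ?sm x * a x y)" by (rule sum.swap)
    then show ?thesis by (simp only: sum.distrib sum_distrib_left[symmetric])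
  qed
  also have "\<dots> \<le> 2 * (M * s * \<Delta>) + 2 * \<theta> * (card V)\<^sup>2
      + 20 / \<theta> * (kenergy V a Q - kenergy V a P) + 20 / \<theta> * (kenergy V a R - kenergy V a P)"
  proof (intro add_mono sum_not_few_sparse_le ref \<theta> mult_left_mono)
    have "(\<Sum>x\<in>V. ?sm x * (\<Sum>y\<in>V. a x y)) \<le> (\<Sum>x\<in>V. ?sm x * \<Delta>)"
      using degree_le by (intro sum_mono mult_left_mono) auto
    also have "\<dots> = card {x \<in> V. card (fibre V P x) < s} * \<Delta>"
      using finV by (simp add: sum_distrib_right[symmetric] sum.inter_filter[symmetric] of_bool_def)
    also have "\<dots> \<le> M * s * \<Delta>"
      using card_small_fibres_le[OF finV P s] \<Delta>_nonneg by (intro mult_right_mono)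
    finally show "(\<Sum>x\<in>V. ?sm x * (\<Sum>y\<in>V. a x y)) \<le> M * s * \<Delta>" .
  next
    let ?U = "V \<times> V" and ?l = "map_prod P P" and ?f = "case_prod a"
    have "(\<Sum>x\<in>V. \<Sum>y\<in>V. a x y * of_bool (dens V a P x y < 2 * \<theta>))
        = (\<Sum>u\<in>?U. ?f u * of_bool (avg ?U ?l ?f u < 2 * \<theta>))"
      unfolding dens_def sum.cartesian_product by (simp add: split_def)
    also have "\<dots> = (\<Sum>u\<in>?U. avg ?U ?l ?f u * of_bool (avg ?U ?l ?f u < 2 * \<theta>))"
    proof (rule sum_avg_mult[symmetric])
      fix u v assume "?l v = ?l u"
      then have "avg ?U ?l ?f v = avg ?U ?l ?f u" by (rule avg_cong)
      then show "of_bool (avg ?U ?l ?f v < 2 * \<theta>) = (of_bool (avg ?U ?l ?f u < 2 * \<theta>) :: real)"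
        by (simp only:)
    qed (use finV in simp)
    also have "\<dots> \<le> (\<Sum>u\<in>?U. 2 * \<theta>)"
      using \<theta> by (intro sum_mono) (auto simp: of_bool_def)
    also have "\<dots> = 2 * \<theta> * (card V)\<^sup>2"
      by (simp add: card_cartesian_product power2_eq_square)
    finally show "(\<Sum>x\<in>V. \<Sum>y\<in>V. a x y * of_bool (dens V a P x y < 2 * \<theta>)) \<le> 2 * \<theta> * (card V)\<^sup>2"
      by simp
  qed simp
  finally show ?thesis .
qed

text \<open>Only the parts containing the five vertices matter: a cycle of good pairs makes these
  parts large and the pairs between them dense, so the count of walks through them applies.\<close>

lemma good_pentagon_walks:
  fixes P Q R :: "'a \<Rightarrow> nat" and \<theta> \<zeta> \<zeta>' s :: real
  assumes Q: "Q ` V \<subseteq> {..<k}" and reg: "cut_regular V a Q \<zeta>" "cut_regular V a R \<zeta>'"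
    and nonneg: "0 \<le> \<theta>" "0 \<le> \<zeta>" "0 \<le> \<zeta>'" "0 \<le> s"
    and g: "good P Q R \<theta> s x1 x2" "good P Q R \<theta> s x2 x3" "good P Q R \<theta> s x3 x4"
      "good P Q R \<theta> s x4 x5" "good P Q R \<theta> s x1 x5"
  shows "\<theta> ^ 5 * (s ^ 5 / 2)
      - (2 * \<theta> ^ 4 * (real k)\<^sup>2 * card V ^ 3 * \<zeta>' + card V * \<zeta> + 2 * \<theta> * card V * \<Delta> ^ 3
         + \<theta> * card V * \<Delta> * \<zeta> + \<theta>\<^sup>2 * (card V)\<^sup>2 * \<zeta> + \<theta> ^ 3 * card V ^ 3 * \<Delta>)
    \<le> (\<Sum>x1\<in>V. \<Sum>x3\<in>V. \<Sum>x4\<in>V. a x3 x4 * (paths V x1 x3 * paths V x1 x4))"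
proof -
  let ?V1 = "fibre V P x1" and ?V2 = "fibre V P x2" and ?V3 = "fibre V P x3"
    and ?V4 = "fibre V P x4" and ?V5 = "fibre V P x5"
  have sub: "fibre V P x \<subseteq> V" for x by (auto simp: fibre_def)
  \<comment> \<open>The density as a function of labels alone. It is defined also for labels that do
    not occur, where it is 0.\<close>
  define dl where "dl = (\<lambda>i j. (\<Sum>u\<in>{u \<in> V. Q u = i}. \<Sum>v\<in>{v \<in> V. Q v = j}. a u v)
     / (card {u \<in> V. Q u = i} * card {v \<in> V. Q v = j}))"
  define hl where "hl = (\<lambda>i j. of_bool (\<theta> \<le> dl i j) :: real)"
  have hl: "of_bool (\<theta> \<le> dens V a Q x y) = hl (Q x) (Q y)" for x y
    unfolding hl_def dl_def dens_eq fibre_def ..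
  note few = g[unfolded good_def few_sparse_def hl]
  have "\<theta> ^ 5 * (real (card ?V1) * card ?V2 * card ?V3 * card ?V4 * card ?V5 / 2)
      - (2 * \<theta> ^ 4 * (real k)\<^sup>2 * card V ^ 3 * \<zeta>' + card V * \<zeta> + 2 * \<theta> * card V * \<Delta> ^ 3
         + \<theta> * card V * \<Delta> * \<zeta> + \<theta>\<^sup>2 * (card V)\<^sup>2 * \<zeta> + \<theta> ^ 3 * card V ^ 3 * \<Delta>)
    \<le> (\<Sum>x1\<in>?V1. \<Sum>x3\<in>?V3. \<Sum>x4\<in>?V4. a x3 x4 * (paths ?V2 x1 x3 * paths ?V5 x1 x4))"
  proof (rule cycle_walks_lower_bound_labels[OF _ _ _ _ nonneg(1,2,3) Q sub sub sub sub sub])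
    show "cut_above (\<lambda>x y. hl (Q x) (Q y)) \<theta> \<zeta>"
      using cut_above_dens[OF reg(1) nonneg(1)] unfolding hl .
    show "cut_above (\<lambda>x y. of_bool (\<theta> \<le> dens V a R x y)) \<theta> \<zeta>'"
      using cut_above_dens[OF reg(2) nonneg(1)] .
  qed (use few in \<open>auto simp: hl_def\<close>)
  moreover have "\<theta> ^ 5 * (s ^ 5 / 2) \<le> \<theta> ^ 5 * (real (card ?V1) * card ?V2 * card ?V3 * card ?V4 * card ?V5 / 2)"
  proof -
    have "s * s * s * s * s \<le> real (card ?V1) * card ?V2 * card ?V3 * card ?V4 * card ?V5"
      using few nonneg(4) by (intro mult_mono mult_nonneg_nonneg) auto
    then show ?thesis using nonneg(1) by (intro mult_left_mono) (auto simp: eval_nat_numeral)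
  qed
  moreover have "(\<Sum>x1\<in>?V1. \<Sum>x3\<in>?V3. \<Sum>x4\<in>?V4. a x3 x4 * (paths ?V2 x1 x3 * paths ?V5 x1 x4))
     \<le> (\<Sum>x1\<in>V. \<Sum>x3\<in>V. \<Sum>x4\<in>V. a x3 x4 * (paths V x1 x3 * paths V x1 x4))"
  proof -
    have p: "paths (fibre V P z) x y \<le> paths V x y" for x y z
      unfolding paths_def using finV sub a_nonneg by (intro sum_mono2) auto
    have m: "sum f (fibre V P x) \<le> sum f' V" if "\<And>z. f z \<le> f' z" "\<And>z. 0 \<le> f' z" for f f' :: "'a \<Rightarrow> real" and x
      using sum_mono[of "fibre V P x" f f'] sum_mono2[OF finV sub[of x], of f'] that by force
    show ?thesis
      by (intro m mult_left_mono mult_mono p paths_nonneg a_nonneg sum_nonneg mult_nonneg_nonneg)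
  qed
  ultimately show ?thesis by linarith
qed

end

section \<open>Degenerate closed walks\<close>

context c4_free_kernel
begin

definition closed_walks :: "('a \<times> 'a \<times> 'a \<times> 'a \<times> 'a) set" where
  "closed_walks = {(x1, x2, x3, x4, x5). {x1, x2, x3, x4, x5} \<subseteq> V \<and>
     a x1 x2 = 1 \<and> a x2 x3 = 1 \<and> a x3 x4 = 1 \<and> a x4 x5 = 1 \<and> a x5 x1 = 1}"

definition pentagons :: "('a \<times> 'a \<times> 'a \<times> 'a \<times> 'a) set" where
  "pentagons = {(x1, x2, x3, x4, x5) \<in> closed_walks. distinct [x1, x2, x3, x4, x5]}"

lemma finite_closed_walks: "finite closed_walks"
  by (rule finite_subset[of _ "V \<times> V \<times> V \<times> V \<times> V"]) (auto simp: closed_walks_def finV)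

text \<open>A closed walk is given by \<open>x1\<close>, \<open>x3\<close>, \<open>x4\<close> and
  the midpoints \<open>x2\<close> and \<open>x5\<close> of two paths from \<open>x1\<close>; the
  product of the five entries is its indicator.\<close>

lemma card_closed_walks:
  "(\<Sum>x1\<in>V. \<Sum>x3\<in>V. \<Sum>x4\<in>V. a x3 x4 * (paths V x1 x3 * paths V x1 x4)) = card closed_walks"
proof -
  have "(\<Sum>x1\<in>V. \<Sum>x3\<in>V. \<Sum>x4\<in>V. a x3 x4 * (paths V x1 x3 * paths V x1 x4))
    = (\<Sum>x1\<in>V. \<Sum>x3\<in>V. \<Sum>x4\<in>V. \<Sum>x2\<in>V. \<Sum>x5\<in>V. a x3 x4 * (a x1 x2 * a x2 x3 * (a x1 x5 * a x5 x4)))"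
    unfolding paths_def sum_product unfolding sum_distrib_left ..
  also have "\<dots> = (\<Sum>t\<in>V \<times> V \<times> V \<times> V \<times> V. of_bool (t \<in> closed_walks))"
    unfolding sum.cartesian_product
  proof (rule sum.reindex_bij_witness[of _ "\<lambda>(x1, x2, x3, x4, x5). (x1, x3, x4, x2, x5)"
        "\<lambda>(x1, x3, x4, x2, x5). (x1, x2, x3, x4, x5)"])
    fix t assume "t \<in> V \<times> V \<times> V \<times> V \<times> V"
    then obtain x1 x2 x3 x4 x5 where t: "t = (x1, x3, x4, x2, x5)" and V: "{x1, x2, x3, x4, x5} \<subseteq> V"
      by auto
    have "(of_bool ((x1, x2, x3, x4, x5) \<in> closed_walks) :: real)
        = a x3 x4 * (a x1 x2 * a x2 x3 * (a x1 x5 * a x5 x4))"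
    proof -
      have ob: "\<exists>p. a x y = of_bool p" for x y using a01[of x y] by (metis of_bool_eq)
      obtain p1 p2 p3 p4 p5 where p: "a x1 x2 = of_bool p1" "a x2 x3 = of_bool p2" "a x3 x4 = of_bool p3"
          "a x4 x5 = of_bool p4" "a x5 x4 = of_bool p4" "a x5 x1 = of_bool p5" "a x1 x5 = of_bool p5"
        using ob[of x1 x2] ob[of x2 x3] ob[of x3 x4] ob[of x4 x5] ob[of x5 x1] a_sym by metis
      have "(x1, x2, x3, x4, x5) \<in> closed_walks \<longleftrightarrow> p1 \<and> p2 \<and> p3 \<and> p4 \<and> p5"
        using V by (simp add: closed_walks_def p)
      then show ?thesis by (simp add: p of_bool_conj)
    qed
    then show "of_bool ((case t of (x1, x3, x4, x2, x5) \<Rightarrow> (x1, x2, x3, x4, x5)) \<in> closed_walks)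
      = (case t of (x1, x3, x4, x2, x5) \<Rightarrow> a x3 x4 * (a x1 x2 * a x2 x3 * (a x1 x5 * a x5 x4)))"
      unfolding t by simp
  qed auto
  also have "\<dots> = (\<Sum>t\<in>closed_walks. 1)"
    using finV by (intro sum.mono_neutral_cong_right) (auto simp: closed_walks_def)
  finally show ?thesis by simp
qed

text \<open>With \<open>x1 = x3\<close> there are at most \<Delta> choices for each of
  \<open>x2\<close> and \<open>x4\<close>. Irreflexivity makes \<open>x4\<close> differ from
  \<open>x1\<close>, so their common neighbour \<open>x5\<close> is determined.\<close>

lemma card_degenerate_walks_le:
  assumes irrefl: "\<And>x. a x x = 0"
  shows "real (card {(x1, x2, x3, x4, x5) \<in> closed_walks. x1 = x3}) \<le> card V * \<Delta>\<^sup>2"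
proof -
  let ?D = "{(x1, x2, x3, x4, x5) \<in> closed_walks. x1 = x3}"
  have "real (card ?D) = (\<Sum>t\<in>?D. 1)" by simp
  also have "\<dots> = (\<Sum>t\<in>V \<times> V \<times> V \<times> V \<times> V. of_bool (t \<in> ?D))"
    using finV by (intro sum.mono_neutral_cong_left) (auto simp: closed_walks_def)
  also have "\<dots> = (\<Sum>x1\<in>V. \<Sum>x2\<in>V. \<Sum>x3\<in>V. \<Sum>x4\<in>V. \<Sum>x5\<in>V. of_bool ((x1, x2, x3, x4, x5) \<in> ?D))"
    by (simp add: sum.cartesian_product split_def)
  also have "\<dots> \<le> (\<Sum>x1\<in>V. \<Sum>x2\<in>V. \<Sum>x3\<in>V. if x3 = x1 then a x1 x2 * (\<Sum>x4\<in>V. a x1 x4 * paths V x4 x1) else 0)"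
  proof (intro sum_mono)
    fix x1 x2 x3
    show "(\<Sum>x4\<in>V. \<Sum>x5\<in>V. of_bool ((x1, x2, x3, x4, x5) \<in> ?D))
        \<le> (if x3 = x1 then a x1 x2 * (\<Sum>x4\<in>V. a x1 x4 * paths V x4 x1) else 0)"
    proof (cases "x3 = x1")
      case True
      show ?thesis unfolding paths_def sum_distrib_left if_P[OF True]
      proof (intro sum_mono)
        fix x4 x5
        show "of_bool ((x1, x2, x3, x4, x5) \<in> ?D) \<le> a x1 x2 * (a x1 x4 * (a x4 x5 * a x5 x1))"
          using True a_nonneg by (auto simp: closed_walks_def of_bool_def)
      qed
    qed simp
  qed
  also have "\<dots> = (\<Sum>x1\<in>V. (\<Sum>x2\<in>V. a x1 x2) * (\<Sum>x4\<in>V. a x1 x4 * paths V x4 x1))"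
    using finV by (simp add: sum.delta sum_distrib_right)
  also have "\<dots> \<le> (\<Sum>x1\<in>V. \<Delta> * \<Delta>)"
  proof (intro sum_mono mult_mono)
    fix x1 assume x1: "x1 \<in> V"
    show "(\<Sum>x2\<in>V. a x1 x2) \<le> \<Delta>" using x1 by (rule degree_le)
    have "(\<Sum>x4\<in>V. a x1 x4 * paths V x4 x1) \<le> (\<Sum>x4\<in>V. a x1 x4)"
    proof (intro sum_mono)
      fix x4 assume "x4 \<in> V"
      then show "a x1 x4 * paths V x4 x1 \<le> a x1 x4"
        using codegree_le[of x4 x1] x1 irrefl a_nonneg[of x1 x4]
        by (cases "x4 = x1") (auto simp: paths_def intro: mult_left_le)
    qed
    also have "\<dots> \<le> \<Delta>" using x1 by (rule degree_le)
    finally show "(\<Sum>x4\<in>V. a x1 x4 * paths V x4 x1) \<le> \<Delta>" .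
  qed (simp_all add: \<Delta>_nonneg sum_nonneg a_nonneg paths_nonneg)
  finally show ?thesis by (simp add: power2_eq_square)
qed

text \<open>Consecutive vertices differ by irreflexivity, so a repetition occurs at distance two.
  Rotating the walk carries the five possible repetitions into each other, and the bound for
  \<open>x1 = x3\<close> serves for all of them.\<close>

lemma closed_walks_le_pentagons:
  assumes irrefl: "\<And>x. a x x = 0"
  shows "real (card closed_walks) \<le> card pentagons + 5 * (card V * \<Delta>\<^sup>2)"
proof -
  define D where "D = (\<lambda>P. {t \<in> closed_walks. case t of (x1, x2, x3, x4, x5) \<Rightarrow> P x1 x2 x3 x4 x5})"
  define rot where "rot = (\<lambda>(x1, x2, x3, x4, x5). (x2 :: 'a, x3 :: 'a, x4 :: 'a, x5 :: 'a, x1 :: 'a))"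
  have fin: "finite (D P)" for P by (simp add: D_def finite_closed_walks)
  have inj: "inj_on rot X" for X by (auto simp: inj_on_def rot_def)
  have rot_le: "card (D P) \<le> card (D P')"
    if "\<And>x1 x2 x3 x4 x5. P x1 x2 x3 x4 x5 \<Longrightarrow> P' x2 x3 x4 x5 x1" for P P'
    by (rule card_inj_on_le[OF inj _ fin]) (use that in \<open>auto simp: D_def rot_def closed_walks_def\<close>)
  let ?D13 = "D (\<lambda>x1 x2 x3 x4 x5. x1 = x3)" and ?D24 = "D (\<lambda>x1 x2 x3 x4 x5. x2 = x4)"
    and ?D35 = "D (\<lambda>x1 x2 x3 x4 x5. x3 = x5)" and ?D41 = "D (\<lambda>x1 x2 x3 x4 x5. x4 = x1)"
    and ?D52 = "D (\<lambda>x1 x2 x3 x4 x5. x5 = x2)"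
  have le: "card ?D24 \<le> card ?D13" "card ?D35 \<le> card ?D24" "card ?D41 \<le> card ?D35" "card ?D52 \<le> card ?D41"
    by (rule rot_le, simp)+
  have "closed_walks \<subseteq> pentagons \<union> (?D13 \<union> (?D24 \<union> (?D35 \<union> (?D41 \<union> ?D52))))"
  proof
    fix t assume t: "t \<in> closed_walks"
    obtain x1 x2 x3 x4 x5 where [simp]: "t = (x1, x2, x3, x4, x5)" by (cases t) auto
    have "x1 \<noteq> x2" "x2 \<noteq> x3" "x3 \<noteq> x4" "x4 \<noteq> x5" "x5 \<noteq> x1"
      using t irrefl by (auto simp: closed_walks_def)
    then show "t \<in> pentagons \<union> (?D13 \<union> (?D24 \<union> (?D35 \<union> (?D41 \<union> ?D52))))"
      using t by (auto simp: pentagons_def D_def)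
  qed
  then have "card closed_walks \<le> card (pentagons \<union> (?D13 \<union> (?D24 \<union> (?D35 \<union> (?D41 \<union> ?D52)))))"
    using fin finite_subset[OF _ finite_closed_walks, of pentagons]
    by (intro card_mono) (auto simp: pentagons_def)
  also have "\<dots> \<le> card pentagons + (card ?D13 + (card ?D24 + (card ?D35 + (card ?D41 + card ?D52))))"
    by (intro order_trans[OF card_Un_le] add_left_mono card_Un_le)
  finally have "real (card closed_walks) \<le> card pentagons + 5 * real (card ?D13)" using le by linarith
  moreover have "?D13 = {(x1, x2, x3, x4, x5) \<in> closed_walks. x1 = x3}" by (auto simp: D_def)
  then have "real (card ?D13) \<le> card V * \<Delta>\<^sup>2" using card_degenerate_walks_le[OF irrefl] by (simp only:)
  ultimately show ?thesis by linarith
qed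

end

section \<open>Removal of 5-cycles\<close>

lemma edge_in_graph_on:
  assumes "graph_on n E" "{x, y} \<in> E"
  shows "x \<noteq> y" "x < n" "y < n"
  using assms unfolding graph_on_def by (fastforce simp: doubleton_eq_iff)+

lemma finite_graph_on: "graph_on n E \<Longrightarrow> finite E"
  by (rule finite_subset[of _ "Pow {..<n}"]) (auto simp: graph_on_def)

lemma cycle_edges_4: "cycle_edges 4 f = {{f 0, f 1}, {f 1, f 2}, {f 2, f 3}, {f 3, f 0}}"
proof -
  have 1: "{..<4::nat} = {0, 1, 2, 3}" by auto
  have 2: "Suc 0 mod 4 = 1" "Suc 1 mod 4 = 2" "Suc 2 mod 4 = 3" "Suc 3 mod 4 = 0" by simp_all
  show ?thesis unfolding cycle_edges_def 1 image_insert image_empty 2 ..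
qed

lemma cycle_edges_5:
  "cycle_edges 5 f = {{f 0, f 1}, {f 1, f 2}, {f 2, f 3}, {f 3, f 4}, {f 4, f 0}}"
proof -
  have 1: "{..<5::nat} = {0, 1, 2, 3, 4}" by auto
  have 2: "Suc 0 mod 5 = 1" "Suc 1 mod 5 = 2" "Suc 2 mod 5 = 3" "Suc 3 mod 5 = 4" "Suc 4 mod 5 = 0"
    by simp_all
  show ?thesis unfolding cycle_edges_def 1 image_insert image_empty 2 ..
qed

lemma C4_free_common_neighbour_unique:
  assumes G: "graph_on n E" and free: "cycle_free 4 E" and "x \<noteq> y"
    and e: "{x, z} \<in> E" "{z, y} \<in> E" "{x, w} \<in> E" "{w, y} \<in> E"
  shows "z = w"
proof (rule ccontr)
  assume "z \<noteq> w"
  then have "distinct [x, z, y, w]"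
    using \<open>x \<noteq> y\<close> edge_in_graph_on[OF G e(1)] edge_in_graph_on[OF G e(2)]
      edge_in_graph_on[OF G e(3)] edge_in_graph_on[OF G e(4)] by auto
  then have "inj_on (nth [x, z, y, w]) {..<4}" by (intro inj_on_nth) auto
  moreover have "cycle_edges 4 (nth [x, z, y, w]) \<subseteq> E"
    unfolding cycle_edges_4 using e by (auto simp: insert_commute)
  ultimately show False using free unfolding cycle_free_def cycle_copies_def by blast
qed

section \<open>Pruning vertices of high degree\<close>

definition degree_in :: "nat \<Rightarrow> nat set set \<Rightarrow> nat \<Rightarrow> real" where
  "degree_in n E x = (\<Sum>y<n. of_bool ({x, y} \<in> E))"

text \<open>Degrees are those of the original graph, so pruning is done in one round and an edge is
  dropped exactly when one of its ends exceeds \<Delta>.\<close>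

definition prune :: "nat \<Rightarrow> nat set set \<Rightarrow> real \<Rightarrow> nat \<Rightarrow> nat \<Rightarrow> real" where
  "prune n E \<Delta> x y = of_bool ({x, y} \<in> E \<and> degree_in n E x \<le> \<Delta> \<and> degree_in n E y \<le> \<Delta>)"

lemma c4_free_kernel_prune:
  assumes G: "graph_on n E" and free: "cycle_free 4 E" and \<Delta>: "0 \<le> \<Delta>"
  shows "c4_free_kernel {..<n} (prune n E \<Delta>) \<Delta>"
proof
  show "prune n E \<Delta> x y = 0 \<or> prune n E \<Delta> x y = 1" for x y by (simp add: prune_def)
  show "prune n E \<Delta> x y = prune n E \<Delta> y x" for x y by (auto simp: prune_def insert_commute)
  show "(\<Sum>z<n. prune n E \<Delta> x z * prune n E \<Delta> z y) \<le> 1" if "x \<noteq> y" for x y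
  proof -
    let ?S = "{z \<in> {..<n}. {x, z} \<in> E \<and> {z, y} \<in> E}"
    have "(\<Sum>z<n. prune n E \<Delta> x z * prune n E \<Delta> z y) \<le> (\<Sum>z<n. of_bool (z \<in> ?S))"
      by (intro sum_mono) (auto simp: prune_def)
    also have "\<dots> = real (card ?S)"
      by (simp add: of_bool_def sum.inter_filter[symmetric])
    also have "card ?S \<le> Suc 0"
      using C4_free_common_neighbour_unique[OF G free that] by (subst card_le_Suc0_iff_eq) auto
    finally show ?thesis by simp
  qed
  show "(\<Sum>y<n. prune n E \<Delta> x y) \<le> \<Delta>" for x
  proof (cases "degree_in n E x \<le> \<Delta>")
    case True
    have "(\<Sum>y<n. prune n E \<Delta> x y) \<le> degree_in n E x"
      unfolding degree_in_def prune_def by (intro sum_mono) (auto simp: of_bool_def)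
    then show ?thesis using True by linarith
  qed (simp add: prune_def \<Delta>)
qed (use \<Delta> in auto)

lemma degree_in_le: "degree_in n E x \<le> n"
  unfolding degree_in_def using sum_bounded_above[of "{..<n}" "\<lambda>y. of_bool ({x, y} \<in> E)" "1 :: real"] by simp

text \<open>The squared degrees sum to at most \<open>2 * n\<^sup>2\<close>, and a degree above
  \<Delta> is at most its square over \<Delta>.\<close>

lemma sum_high_degrees_le:
  assumes G: "graph_on n E" and free: "cycle_free 4 E" and \<Delta>: "0 < \<Delta>"
  shows "(\<Sum>x<n. degree_in n E x * of_bool (\<Delta> < degree_in n E x)) \<le> 2 * n\<^sup>2 / \<Delta>"
proof -
  \<comment> \<open>At threshold \<open>n\<close> nothing is pruned, so the bound on squared degrees
    speaks of the graph itself.\<close>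
  interpret c4_free_kernel "{..<n}" "prune n E n" "real n"
    using G free by (rule c4_free_kernel_prune) simp
  have "prune n E n x y = of_bool ({x, y} \<in> E)" for x y
    by (simp add: prune_def degree_in_le)
  then have sq: "(\<Sum>x<n. (degree_in n E x)\<^sup>2) \<le> 2 * n\<^sup>2"
    using sum_square_degree_le[of "{..<n}"] by (simp add: degree_in_def power2_eq_square)
  have "(\<Sum>x<n. degree_in n E x * of_bool (\<Delta> < degree_in n E x)) \<le> (\<Sum>x<n. (degree_in n E x)\<^sup>2 / \<Delta>)"
  proof (intro sum_mono)
    fix x
    show "degree_in n E x * of_bool (\<Delta> < degree_in n E x) \<le> (degree_in n E x)\<^sup>2 / \<Delta>"
      using \<Delta> by (auto simp: of_bool_def field_simps power2_eq_square intro!: mult_left_mono)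
  qed
  also have "\<dots> \<le> 2 * n\<^sup>2 / \<Delta>"
    unfolding sum_divide_distrib[symmetric] using sq \<Delta> by (intro divide_right_mono) auto
  finally show ?thesis by simp
qed

lemma card_edges_le_ordered_sum:
  fixes B :: "nat \<Rightarrow> nat \<Rightarrow> bool"
  shows "real (card ((\<lambda>(x, y). {x, y}) ` {(x, y). x < n \<and> y < n \<and> B x y}))
    \<le> (\<Sum>x<n. \<Sum>y<n. of_bool (B x y))"
proof -
  have "card ((\<lambda>(x, y). {x, y}) ` {(x, y). x < n \<and> y < n \<and> B x y}) \<le> card {(x, y). x < n \<and> y < n \<and> B x y}"
    by (rule card_image_le, rule finite_subset[of _ "{..<n} \<times> {..<n}"]) auto
  also have "real \<dots> = (\<Sum>t\<in>{(x, y). x < n \<and> y < n \<and> B x y}. 1)" by simp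
  also have "\<dots> = (\<Sum>t\<in>{..<n} \<times> {..<n}. of_bool (case t of (x, y) \<Rightarrow> B x y))"
    by (intro sum.mono_neutral_cong_left) auto
  also have "\<dots> = (\<Sum>x<n. \<Sum>y<n. of_bool (B x y))"
    unfolding sum.cartesian_product by (intro sum.cong refl) auto
  finally show ?thesis by simp
qed

text \<open>A pentagon is a 5-tuple over the vertices of the copy that it traces. A copy has at most
  5 vertices, hence at most 5^5 = 3125 such tuples.\<close>

lemma pentagons_le_copies:
  assumes G: "graph_on n E" and free: "cycle_free 4 E" and \<Delta>: "0 \<le> \<Delta>"
  shows "card (c4_free_kernel.pentagons {..<n} (prune n E \<Delta>)) \<le> 3125 * card (cycle_copies 5 E)"
proof -
  interpret c4_free_kernel "{..<n}" "prune n E \<Delta>" \<Delta>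
    using assms by (rule c4_free_kernel_prune)
  define T where "T = (\<lambda>C :: nat set set. \<Union>C \<times> \<Union>C \<times> \<Union>C \<times> \<Union>C \<times> \<Union>C)"
  have T: "finite (T C) \<and> card (T C) \<le> 3125" if "C \<in> cycle_copies 5 E" for C
  proof -
    obtain f where "C = cycle_edges 5 f" using \<open>C \<in> cycle_copies 5 E\<close> unfolding cycle_copies_def by blast
    then have U: "\<Union>C = set [f 0, f 1, f 2, f 3, f 4]" by (auto simp: cycle_edges_5)
    have 5: "card (\<Union>C) \<le> 5" unfolding U using card_length[of "[f 0, f 1, f 2, f 3, f 4]"] by simp
    have "card (T C) = card (\<Union>C) ^ 5"
      by (simp add: T_def card_cartesian_product eval_nat_numeral)
    also have "\<dots> \<le> 5 ^ 5" using 5 by (rule power_mono) simp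
    finally have "card (T C) \<le> 3125" by simp
    moreover have "finite (\<Union>C)" unfolding U by (rule finite_set)
    then have "finite (T C)" unfolding T_def by (intro finite_cartesian_product)
    ultimately show ?thesis by simp
  qed
  have finC: "finite (cycle_copies 5 E)"
    by (rule finite_subset[of _ "Pow E"]) (auto simp: cycle_copies_def finite_graph_on[OF G])
  have "pentagons \<subseteq> (\<Union>C\<in>cycle_copies 5 E. T C)"
  proof
    fix t assume t: "t \<in> pentagons"
    obtain x1 x2 x3 x4 x5 where tx: "t = (x1, x2, x3, x4, x5)" by (cases t) auto
    let ?f = "nth [x1, x2, x3, x4, x5]"
    have d: "distinct [x1, x2, x3, x4, x5]"
      and e: "{x1, x2} \<in> E" "{x2, x3} \<in> E" "{x3, x4} \<in> E" "{x4, x5} \<in> E" "{x5, x1} \<in> E"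
      using t unfolding tx pentagons_def closed_walks_def by (auto simp: prune_def of_bool_def split: if_splits)
    have ce: "cycle_edges 5 ?f = {{x1, x2}, {x2, x3}, {x3, x4}, {x4, x5}, {x5, x1}}"
      by (simp add: cycle_edges_5)
    have "inj_on ?f {..<5}" using d by (intro inj_on_nth) auto
    then have "cycle_edges 5 ?f \<in> cycle_copies 5 E"
      using e unfolding cycle_copies_def ce[symmetric] by (auto simp: ce)
    moreover have "{x1, x2, x3, x4, x5} \<subseteq> \<Union>(cycle_edges 5 ?f)" unfolding ce by simp
    then have "t \<in> T (cycle_edges 5 ?f)" unfolding T_def tx mem_Times_iff fst_conv snd_conv by blast
    ultimately show "t \<in> (\<Union>C\<in>cycle_copies 5 E. T C)" by blast
  qed
  then have "card pentagons \<le> card (\<Union>C\<in>cycle_copies 5 E. T C)"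
    using finC T by (intro card_mono) auto
  also have "\<dots> \<le> (\<Sum>C\<in>cycle_copies 5 E. card (T C))" using finC by (rule card_UN_le)
  also have "\<dots> \<le> (\<Sum>C\<in>cycle_copies 5 E. 3125)" using T by (intro sum_mono) auto
  finally show ?thesis by simp
qed

text \<open>A 5-cycle avoiding the deleted edges consists of good pairs and forces more closed walks
  than \<open>few\<close> permits: on the left of \<open>few\<close> stand the copies and the
  degenerate walks, on the right the guaranteed number of walks.\<close>

lemma C5_removal_from_partitions:
  fixes r K d \<gamma> \<eta> \<eta>' \<epsilon> :: real and P Q R :: "nat \<Rightarrow> nat"
  assumes G: "graph_on n E" and free: "cycle_free 4 E" and r: "0 < r" "r\<^sup>2 = n"
    and pos: "0 < K" "0 < d" "0 < \<gamma>" "0 \<le> \<eta>" "0 \<le> \<eta>'" "0 < M"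
    and P: "P ` {..<n} \<subseteq> {..<M}" and Q: "Q ` {..<n} \<subseteq> {..<k}"
    and ref: "refines {..<n} Q P" "refines {..<n} R Q"
    and reg: "cut_regular {..<n} (prune n E (K * r)) Q (\<eta> * r ^ 3)"
      "cut_regular {..<n} (prune n E (K * r)) R (\<eta>' * r ^ 3)"
    and en: "kenergy {..<n} (prune n E (K * r)) R - kenergy {..<n} (prune n E (K * r)) P \<le> \<epsilon> * n"
    and few: "3125 * real (card (cycle_copies 5 E)) + 5 * K\<^sup>2 * r ^ 4
      < ((d * \<gamma> / (2 * real M)) ^ 5 / 2 - (d ^ 4 / 8 * (real k)\<^sup>2 * \<eta>' + \<eta> * (1 + d * K / 2 + d\<^sup>2 / 4))) * r ^ 5
        - (d * K ^ 3 + d ^ 3 * K / 8) * r ^ 4"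
  shows "\<exists>F\<subseteq>E. card F \<le> (2 / K + 2 * \<gamma> * K + d + 80 * \<epsilon> / d) * r ^ 3 \<and> cycle_free 5 (E - F)"
proof -
  \<comment> \<open>The sparse scale: degrees are of order \<open>r\<close>, densities of order
    \<open>1 / r\<close>, and \<open>s\<close> is \<gamma> times the mean size of \<open>M\<close>
    parts.\<close>
  define \<Delta> where "\<Delta> = K * r"
  define \<theta> where "\<theta> = d / (2 * r)"
  define s where "s = \<gamma> * r\<^sup>2 / M"
  have \<Delta>: "0 < \<Delta>" and \<theta>: "0 < \<theta>" and s: "0 \<le> s"
    using r pos by (auto simp: \<Delta>_def \<theta>_def s_def)
  let ?a = "prune n E \<Delta>"
  interpret c4_free_kernel "{..<n}" ?a \<Delta>
    using G free less_imp_le[OF \<Delta>] by (rule c4_free_kernel_prune)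
  have refRP: "refines {..<n} R P" using ref(2,1) by (rule refines_trans)
  let ?edge = "\<lambda>(x, y). {x, y :: nat}"
  let ?good = "good P Q R \<theta> s"
  \<comment> \<open>With both sets deleted, every surviving edge has ends of low degree, hence
    belongs to the pruned kernel, and is a good pair there.\<close>
  define F1 where "F1 = ?edge ` {(x, y). x < n \<and> y < n \<and> {x, y} \<in> E \<and> \<Delta> < degree_in n E x}"
  define F2 where "F2 = ?edge ` {(x, y). x < n \<and> y < n \<and> ?a x y = 1 \<and> \<not> ?good x y}"
  have "F1 \<union> F2 \<subseteq> E"
    by (auto simp: F1_def F2_def prune_def of_bool_def split: if_splits)
  moreover have "card (F1 \<union> F2) \<le> (2 / K + 2 * \<gamma> * K + d + 80 * \<epsilon> / d) * r ^ 3"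
  proof -
    have "real (card F1) \<le> (\<Sum>x<n. \<Sum>y<n. of_bool ({x, y} \<in> E \<and> \<Delta> < degree_in n E x))"
      unfolding F1_def by (rule card_edges_le_ordered_sum)
    also have "\<dots> = (\<Sum>x<n. degree_in n E x * of_bool (\<Delta> < degree_in n E x))"
      by (simp add: degree_in_def of_bool_conj sum_distrib_right)
    also have "\<dots> \<le> 2 * (real n)\<^sup>2 / \<Delta>" using G free \<Delta> by (rule sum_high_degrees_le)
    also have "\<dots> = 2 / K * r ^ 3"
      using r(1) pos unfolding \<Delta>_def of_nat_power r(2)[symmetric]
      by (simp add: field_simps eval_nat_numeral)
    finally have F1: "card F1 \<le> 2 / K * r ^ 3" .
    have "real (card F2) \<le> (\<Sum>x<n. \<Sum>y<n. of_bool (?a x y = 1 \<and> \<not> ?good x y))"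
      unfolding F2_def by (rule card_edges_le_ordered_sum)
    also have "\<dots> = (\<Sum>x<n. \<Sum>y<n. ?a x y * of_bool (\<not> ?good x y))"
      by (intro sum.cong refl) (auto simp: prune_def)
    also have "\<dots> \<le> 2 * (M * s * \<Delta>) + 2 * \<theta> * (card {..<n})\<^sup>2
        + 20 / \<theta> * (kenergy {..<n} ?a Q - kenergy {..<n} ?a P)
        + 20 / \<theta> * (kenergy {..<n} ?a R - kenergy {..<n} ?a P)"
      using P ref(1) refRP \<theta> s by (rule sum_not_good_le)
    also have "\<dots> \<le> 2 * (M * s * \<Delta>) + 2 * \<theta> * (card {..<n})\<^sup>2
        + 20 / \<theta> * (\<epsilon> * n) + 20 / \<theta> * (\<epsilon> * n)"
    proof -
      have "kenergy {..<n} ?a Q \<le> kenergy {..<n} ?a R"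
        using refines_map_prod[OF ref(2)] by (intro energy_mono) auto
      then show ?thesis
        using en \<theta> unfolding \<Delta>_def by (intro add_mono mult_left_mono order_refl) auto
    qed
    \<comment> \<open>As \<open>1 / \<theta>\<close> is \<open>2 * r / d\<close>, each of the two
      energy terms contributes \<open>40 * \<epsilon> / d\<close> in units of
      \<open>r ^ 3\<close>.\<close>
    also have "\<dots> = (2 * \<gamma> * K + d + 80 * \<epsilon> / d) * r ^ 3"
      using r(1) pos unfolding \<Delta>_def \<theta>_def s_def card_lessThan of_nat_power r(2)[symmetric]
      by (simp add: field_simps eval_nat_numeral)
    finally have F2: "card F2 \<le> (2 * \<gamma> * K + d + 80 * \<epsilon> / d) * r ^ 3" .
    have "real (card (F1 \<union> F2)) \<le> card F1 + card F2" using card_Un_le[of F1 F2] by linarith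
    also have "\<dots> \<le> 2 / K * r ^ 3 + (2 * \<gamma> * K + d + 80 * \<epsilon> / d) * r ^ 3"
      using F1 F2 by linarith
    finally show ?thesis by (simp add: algebra_simps)
  qed
  moreover have "cycle_free 5 (E - (F1 \<union> F2))"
  proof (rule ccontr)
    assume "\<not> cycle_free 5 (E - (F1 \<union> F2))"
    then obtain f where "cycle_edges 5 f \<subseteq> E - (F1 \<union> F2)"
      unfolding cycle_free_def cycle_copies_def by blast
    then have e: "{f 0, f 1} \<in> E - (F1 \<union> F2)" "{f 1, f 2} \<in> E - (F1 \<union> F2)" "{f 2, f 3} \<in> E - (F1 \<union> F2)"
      "{f 3, f 4} \<in> E - (F1 \<union> F2)" "{f 0, f 4} \<in> E - (F1 \<union> F2)"
      unfolding cycle_edges_5 by (auto simp: insert_commute)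
    have gd: "?good x y" if xy: "{x, y} \<in> E - (F1 \<union> F2)" for x y
    proof (rule ccontr)
      assume ng: "\<not> ?good x y"
      have E: "{x, y} \<in> E" "{y, x} \<in> E" using xy by (auto simp: insert_commute)
      have n: "x < n" "y < n" using edge_in_graph_on[OF G E(1)] by auto
      have "degree_in n E x \<le> \<Delta>"
      proof (rule ccontr)
        assume "\<not> degree_in n E x \<le> \<Delta>"
        then have "?edge (x, y) \<in> F1" unfolding F1_def using E n by (intro imageI) auto
        then show False using xy by simp
      qed
      moreover have "degree_in n E y \<le> \<Delta>"
      proof (rule ccontr)
        assume "\<not> degree_in n E y \<le> \<Delta>"
        then have "?edge (y, x) \<in> F1" unfolding F1_def using E n by (intro imageI) auto
        then show False using xy by (simp add: insert_commute)
      qed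
      ultimately have "?a x y = 1" using E by (simp add: prune_def)
      then have "?edge (x, y) \<in> F2" unfolding F2_def using ng n by (intro imageI) auto
      then show False using xy by simp
    qed
    have "?a x x = 0" for x using edge_in_graph_on(1)[OF G, of x x] by (auto simp: prune_def)
    then have "real (card closed_walks) \<le> card pentagons + 5 * (card {..<n} * \<Delta>\<^sup>2)"
      by (rule closed_walks_le_pentagons)
    also have "real (card pentagons) \<le> 3125 * real (card (cycle_copies 5 E))"
      using pentagons_le_copies[OF G free less_imp_le[OF \<Delta>]] by linarith
    also have "5 * (card {..<n} * \<Delta>\<^sup>2) = 5 * K\<^sup>2 * r ^ 4"
      unfolding \<Delta>_def card_lessThan r(2)[symmetric] by (simp add: eval_nat_numeral)
    finally have upper: "real (card closed_walks) \<le> 3125 * real (card (cycle_copies 5 E)) + 5 * K\<^sup>2 * r ^ 4"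
      by simp
    have nn: "0 \<le> \<eta> * r ^ 3" "0 \<le> \<eta>' * r ^ 3" using r pos by auto
    have "\<theta> ^ 5 * (s ^ 5 / 2)
      - (2 * \<theta> ^ 4 * (real k)\<^sup>2 * card {..<n} ^ 3 * (\<eta>' * r ^ 3) + card {..<n} * (\<eta> * r ^ 3)
         + 2 * \<theta> * card {..<n} * \<Delta> ^ 3 + \<theta> * card {..<n} * \<Delta> * (\<eta> * r ^ 3)
         + \<theta>\<^sup>2 * (card {..<n})\<^sup>2 * (\<eta> * r ^ 3) + \<theta> ^ 3 * card {..<n} ^ 3 * \<Delta>) \<le> card closed_walks"
      using good_pentagon_walks[OF Q reg[folded \<Delta>_def] less_imp_le[OF \<theta>] nn s
          gd[OF e(1)] gd[OF e(2)] gd[OF e(3)] gd[OF e(4)] gd[OF e(5)]]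
      unfolding card_closed_walks .
    \<comment> \<open>In powers of \<open>r\<close>, the main term and the cut norm errors are of
      order \<open>r ^ 5\<close>; the two diagonal corrections are only of order
      \<open>r ^ 4\<close>.\<close>
    moreover have "\<theta> ^ 5 * (s ^ 5 / 2) = (d * \<gamma> / (2 * real M)) ^ 5 / 2 * r ^ 5"
    proof -
      have "\<theta> * s = d * \<gamma> / (2 * real M) * r"
        using r(1) by (simp add: \<theta>_def s_def power2_eq_square)
      then have "(\<theta> * s) ^ 5 = (d * \<gamma> / (2 * real M) * r) ^ 5" by (rule arg_cong)
      then have "\<theta> ^ 5 * s ^ 5 = (d * \<gamma> / (2 * real M)) ^ 5 * r ^ 5" by (simp only: power_mult_distrib)
      then show ?thesis by simp
    qed
    moreover have "2 * \<theta> ^ 4 * (real k)\<^sup>2 * card {..<n} ^ 3 * (\<eta>' * r ^ 3) = d ^ 4 / 8 * (real k)\<^sup>2 * \<eta>' * r ^ 5"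
      using r(1) unfolding \<theta>_def card_lessThan of_nat_power r(2)[symmetric]
      by (simp add: field_simps eval_nat_numeral)
    moreover have "card {..<n} * (\<eta> * r ^ 3) = \<eta> * r ^ 5"
      unfolding card_lessThan r(2)[symmetric] by (simp add: eval_nat_numeral)
    moreover have "2 * \<theta> * card {..<n} * \<Delta> ^ 3 = d * K ^ 3 * r ^ 4"
      using r(1) unfolding \<theta>_def \<Delta>_def card_lessThan r(2)[symmetric]
      by (simp add: field_simps eval_nat_numeral)
    moreover have "\<theta> * card {..<n} * \<Delta> * (\<eta> * r ^ 3) = \<eta> * (d * K / 2) * r ^ 5"
      using r(1) unfolding \<theta>_def \<Delta>_def card_lessThan r(2)[symmetric]
      by (simp add: field_simps eval_nat_numeral)
    moreover have "\<theta>\<^sup>2 * (card {..<n})\<^sup>2 * (\<eta> * r ^ 3) = \<eta> * (d\<^sup>2 / 4) * r ^ 5"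
      using r(1) unfolding \<theta>_def card_lessThan of_nat_power r(2)[symmetric]
      by (simp add: field_simps eval_nat_numeral)
    moreover have "\<theta> ^ 3 * card {..<n} ^ 3 * \<Delta> = d ^ 3 * K / 8 * r ^ 4"
      using r(1) unfolding \<theta>_def \<Delta>_def card_lessThan of_nat_power r(2)[symmetric]
      by (simp add: field_simps eval_nat_numeral)
    ultimately have "((d * \<gamma> / (2 * real M)) ^ 5 / 2 - (d ^ 4 / 8 * (real k)\<^sup>2 * \<eta>' + \<eta> * (1 + d * K / 2 + d\<^sup>2 / 4))) * r ^ 5
        - (d * K ^ 3 + d ^ 3 * K / 8) * r ^ 4 \<le> card closed_walks"
      unfolding left_diff_distrib distrib_right distrib_left mult_1_right by linarith
    then show False using upper few by linarith
  qed
  ultimately show ?thesis by blast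
qed

section \<open>Choice of constants and the removal theorem\<close>

lemma sqrt_power_eq_powr:
  assumes "0 < x"
  shows "sqrt x ^ k = x powr (k / 2)"
  using assms by (simp add: powr_half_sqrt[symmetric] powr_powr flip: powr_realpow)

theorem theorem1p1:
  fixes \<epsilon> :: real
  assumes "\<epsilon> > 0"
  shows "\<exists>\<delta>::real. \<delta> > 0 \<and> (\<exists>n0::nat. \<forall>n\<ge>n0. \<forall>E.
           graph_on n E \<and> cycle_free 4 E \<and>
           real (card (cycle_copies 5 E)) \<le> \<delta> * real n powr (5/2)
           \<longrightarrow> (\<exists>F. F \<subseteq> E \<and> real (card F) \<le> \<epsilon> * real n powr (3/2)
                    \<and> cycle_free 5 (E - F)))"
proof -
  \<comment> \<open>With these values \<open>2 / K\<close>, \<open>2 * \<gamma> * K\<close> and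
    \<open>d\<close> are each \<epsilon> / 5, and \<open>80 * \<epsilon>' / d\<close> is 2 *
    \<epsilon> / 5, which adds up to \<epsilon>.\<close>
  define K where "K = 10 / \<epsilon>"
  define d where "d = \<epsilon> / 5"
  define \<gamma> where "\<gamma> = \<epsilon>\<^sup>2 / 100"
  define \<epsilon>' where "\<epsilon>' = \<epsilon>\<^sup>2 / 1000"
  \<comment> \<open>When \<open>P\<close> has labels below \<open>M\<close>, the main term has
    coefficient \<open>c / real M ^ 5\<close>. \<open>L\<close> collects the coefficients of the
    regularity errors.\<close>
  define c where "c = (d * \<gamma> / 2) ^ 5 / 2"
  define L where "L = 1 + d * K / 2 + d\<^sup>2 / 4 + d ^ 4 / 8"
  \<comment> \<open>The exponent is 5 + 2: five powers match the loss of \<open>real M ^ 5\<close>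
    in the main term, and two absorb the number of pairs of cells of \<open>Q\<close>.\<close>
  define \<eta> where "\<eta> = (\<lambda>m::nat. c / (4 * L * (real m + 1) ^ 7))"
  define N where "N = (\<lambda>m. nat \<lceil>2 / (\<eta> m)\<^sup>2\<rceil> + 1)"
  define J where "J = nat \<lceil>2 / \<epsilon>'\<rceil> + 1"
  \<comment> \<open>\<open>X\<close> bounds the number of labels of every partition to which the
    energy bound is applied, so \<delta> and \<open>r0\<close> do not depend on
    \<open>n\<close>.\<close>
  define X where "X = real (level N (2 * J))"
  define C where "C = 5 * K\<^sup>2 + d * K ^ 3 + d ^ 3 * K / 8"
  define \<delta> where "\<delta> = c / X ^ 5 / (4 * 3125)"
  \<comment> \<open>The summand \<open>X * K\<close> keeps all energies below \<open>2 * n\<close>;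
    the last summand makes the terms of order \<open>r ^ 4\<close> smaller than half of the main
    term.\<close>
  define r0 where "r0 = 1 + X * K + C * 2 * X ^ 5 / c"
  have pos: "0 < K" "0 < d" "0 < \<gamma>" "0 < \<epsilon>'"
    using \<open>\<epsilon> > 0\<close> by (simp_all add: K_def d_def \<gamma>_def \<epsilon>'_def)
  have c: "0 < c" and L: "1 \<le> L" and X: "0 < X" and C: "0 < C"
    using pos by (simp_all add: c_def L_def X_def C_def level_pos add_pos_pos)
  have \<eta>: "0 < \<eta> m" for m using c L unfolding \<eta>_def by (intro divide_pos_pos mult_pos_pos) auto
  have ceil: "2 < (real (nat \<lceil>2 / y\<rceil> + 1)) * y" if "0 < y" for y :: real
  proof -
    have "2 / y < real (nat \<lceil>2 / y\<rceil> + 1)" by linarith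
    then show ?thesis using that by (simp add: divide_less_eq)
  qed
  have N: "2 < real (N m) * (\<eta> m)\<^sup>2" for m
    unfolding N_def using \<eta>[of m] by (intro ceil) simp
  have J: "2 < real J * \<epsilon>'" unfolding J_def using pos by (intro ceil)
  have \<eta>_le: "\<eta> m \<le> c / (4 * L) / real M ^ 5" "(real m)\<^sup>2 * \<eta> m \<le> c / (4 * L) / real M ^ 5"
    if "0 < M" "M \<le> m" for m M
  proof -
    have M: "0 < real M ^ 5" "real M ^ 5 \<le> (real m + 1) ^ 5"
      using that by (auto intro!: power_mono)
    have "(real m + 1) ^ 7 = (real m + 1) ^ 5 * (real m + 1)\<^sup>2" by (simp flip: power_add)
    then have eq: "\<eta> m = c / (4 * L) / (real m + 1) ^ 5 / (real m + 1)\<^sup>2"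
      by (simp add: \<eta>_def mult.assoc)
    have le: "c / (4 * L) / (real m + 1) ^ 5 \<le> c / (4 * L) / real M ^ 5"
      using M c L by (intro divide_left_mono) auto
    have "\<eta> m \<le> c / (4 * L) / (real m + 1) ^ 5 / 1"
      unfolding eq using c L by (intro divide_left_mono one_le_power divide_nonneg_nonneg) auto
    then show "\<eta> m \<le> c / (4 * L) / real M ^ 5" using le by linarith
    have "(real m)\<^sup>2 * \<eta> m \<le> (real m + 1)\<^sup>2 * \<eta> m"
      using \<eta>[of m] by (intro mult_right_mono power_mono) auto
    also have "\<dots> = c / (4 * L) / (real m + 1) ^ 5" by (simp add: eq)
    finally show "(real m)\<^sup>2 * \<eta> m \<le> c / (4 * L) / real M ^ 5" using le by linarith
  qed
  have "\<exists>F. F \<subseteq> E \<and> real (card F) \<le> \<epsilon> * real n powr (3/2) \<and> cycle_free 5 (E - F)"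
    if n: "n \<ge> nat \<lceil>r0\<^sup>2\<rceil>" and G: "graph_on n E" and free: "cycle_free 4 E"
      and copies: "real (card (cycle_copies 5 E)) \<le> \<delta> * real n powr (5/2)" for n E
  proof -
    define r where "r = sqrt n"
    have r0: "1 \<le> r0" "X * K \<le> r0" "C * 2 * X ^ 5 / c < r0"
      using X pos c C by (simp_all add: r0_def add_pos_nonneg add_nonneg_pos)
    have "r0\<^sup>2 \<le> real n" using n by linarith
    then have "r0 \<le> r" unfolding r_def by (rule real_le_rsqrt)
    then have r: "1 \<le> r" "X * K \<le> r" "C * 2 * X ^ 5 / c < r" using r0 by linarith+
    have r2: "r\<^sup>2 = n" by (simp add: r_def)
    have n0: "0 < real n" using r(1) unfolding r2[symmetric] by (simp add: power_strict_mono)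
    have powr: "real n powr (5/2) = r ^ 5" "real n powr (3/2) = r ^ 3"
      using sqrt_power_eq_powr[OF n0, of 5] sqrt_power_eq_powr[OF n0, of 3] by (simp_all add: r_def)
    let ?a = "prune n E (K * r)"
    interpret c4_free_kernel "{..<n}" ?a "K * r"
      using G free by (rule c4_free_kernel_prune) (use pos r in simp)
    have bound: "\<forall>Q::nat \<Rightarrow> nat. Q ` {..<n} \<subseteq> {..<level N (2 * J)} \<longrightarrow> kenergy {..<n} ?a Q \<le> 2 * card {..<n}"
    proof (intro allI impI)
      fix Q :: "nat \<Rightarrow> nat" assume Q: "Q ` {..<n} \<subseteq> {..<level N (2 * J)}"
      have "kenergy {..<n} ?a Q \<le> card {..<n} + X * (K * r)"
        using kenergy_le[OF Q] by (simp add: X_def)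
      also have "X * (K * r) \<le> r * r"
        using r mult_right_mono[of "X * K" r r] by (simp add: mult.assoc)
      also have "r * r = n" using r2 by (simp add: power2_eq_square)
      finally show "kenergy {..<n} ?a Q \<le> 2 * card {..<n}" by simp
    qed
    have nonempty: "{..<n} \<noteq> {}" and "0 \<le> r" and "r\<^sup>2 = card {..<n}" using n0 r r2 by auto
    note strong_cut_regularity[where \<eta> = \<eta> and N = N, OF finite_lessThan nonempty \<eta> N J this(2,3) bound]
    then
    obtain P Q R :: "nat \<Rightarrow> nat" and j where PQR: "j < J"
      "P ` {..<n} \<subseteq> {..<level N (2 * j)}" "Q ` {..<n} \<subseteq> {..<level N (2 * j + 1)}"
      "refines {..<n} Q P" "refines {..<n} R Q"
      "cut_regular {..<n} ?a Q (\<eta> (level N (2 * j)) * r ^ 3)"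
      "cut_regular {..<n} ?a R (\<eta> (level N (2 * j + 1)) * r ^ 3)"
      "kenergy {..<n} ?a R - kenergy {..<n} ?a P \<le> \<epsilon>' * n"
      unfolding card_lessThan by (elim exE conjE) (rule that)
    define M where "M = level N (2 * j)"
    define k where "k = level N (2 * j + 1)"
    have M: "0 < M" "M \<le> k" "real M \<le> X"
      using PQR(1) unfolding M_def k_def X_def by (auto simp: level_pos intro!: level_mono simp del: level.simps)
    define q where "q = c / real M ^ 5"
    have q: "c / X ^ 5 \<le> q"
      unfolding q_def using M c by (intro divide_left_mono power_mono) auto
    have "d ^ 4 / 8 * (real k)\<^sup>2 * \<eta> k + \<eta> M * (1 + d * K / 2 + d\<^sup>2 / 4)
        \<le> d ^ 4 / 8 * (q / (4 * L)) + (q / (4 * L)) * (1 + d * K / 2 + d\<^sup>2 / 4)"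
    proof (rule add_mono)
      have "d ^ 4 / 8 * ((real k)\<^sup>2 * \<eta> k) \<le> d ^ 4 / 8 * (q / (4 * L))"
        using \<eta>_le(2)[OF M(1,2)] pos by (intro mult_left_mono) (auto simp: q_def mult.commute)
      then show "d ^ 4 / 8 * (real k)\<^sup>2 * \<eta> k \<le> d ^ 4 / 8 * (q / (4 * L))" by (simp only: mult.assoc)
      show "\<eta> M * (1 + d * K / 2 + d\<^sup>2 / 4) \<le> (q / (4 * L)) * (1 + d * K / 2 + d\<^sup>2 / 4)"
        using \<eta>_le(1)[OF M(1) order_refl] pos by (intro mult_right_mono) (auto simp: q_def mult.commute)
    qed
    also have "\<dots> = q / (4 * L) * (d ^ 4 / 8 + (1 + d * K / 2 + d\<^sup>2 / 4))"
      by (simp only: distrib_left[of "q / (4 * L)"] mult.commute[of "d ^ 4 / 8"])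
    also have "d ^ 4 / 8 + (1 + d * K / 2 + d\<^sup>2 / 4) = L" by (simp add: L_def)
    also have "q / (4 * L) * L = q / 4" using L by simp
    finally have err: "d ^ 4 / 8 * (real k)\<^sup>2 * \<eta> k + \<eta> M * (1 + d * K / 2 + d\<^sup>2 / 4) \<le> q / 4" .
    have main: "(d * \<gamma> / (2 * real M)) ^ 5 / 2 = q"
      by (simp add: q_def c_def power_divide power_mult_distrib)
    have "3125 * real (card (cycle_copies 5 E)) \<le> c / X ^ 5 / 4 * r ^ 5"
      using copies unfolding powr \<delta>_def by simp
    also have "\<dots> \<le> q / 4 * r ^ 5" using q r by (intro mult_right_mono) auto
    finally have "3125 * real (card (cycle_copies 5 E)) \<le> q / 4 * r ^ 5" .
    moreover have "C * r ^ 4 < q / 2 * r ^ 5"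
    proof -
      have "C < c / X ^ 5 / 2 * r" using r(3) c X by (simp add: field_simps)
      also have "\<dots> \<le> q / 2 * r" using q r by (intro mult_right_mono) auto
      finally have "C * r ^ 4 < q / 2 * r * r ^ 4" using r by (intro mult_strict_right_mono) auto
      then show ?thesis by (simp add: eval_nat_numeral mult_ac)
    qed
    \<comment> \<open>Of the main term \<open>q * r ^ 5\<close>, one quarter covers the regularity
      errors and one quarter the copies; the lower-order terms stay strictly below the remaining
      half.\<close>
    moreover have "(3 / 4 * q) * r ^ 5
        \<le> ((d * \<gamma> / (2 * real M)) ^ 5 / 2 - (d ^ 4 / 8 * (real k)\<^sup>2 * \<eta> k + \<eta> M * (1 + d * K / 2 + d\<^sup>2 / 4))) * r ^ 5"
      unfolding main using err r by (intro mult_right_mono) auto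
    ultimately have few: "3125 * real (card (cycle_copies 5 E)) + 5 * K\<^sup>2 * r ^ 4
      < ((d * \<gamma> / (2 * real M)) ^ 5 / 2 - (d ^ 4 / 8 * (real k)\<^sup>2 * \<eta> k + \<eta> M * (1 + d * K / 2 + d\<^sup>2 / 4))) * r ^ 5
        - (d * K ^ 3 + d ^ 3 * K / 8) * r ^ 4"
      unfolding C_def distrib_right by linarith
    have "0 < r" using r by simp
    from C5_removal_from_partitions[OF G free this r2 pos(1-3) less_imp_le[OF \<eta>] less_imp_le[OF \<eta>] M(1)
        PQR(2-8)[folded M_def k_def] few]
    obtain F where "F \<subseteq> E" "cycle_free 5 (E - F)"
      "card F \<le> (2 / K + 2 * \<gamma> * K + d + 80 * \<epsilon>' / d) * r ^ 3" by blast
    moreover have "2 / K + 2 * \<gamma> * K + d + 80 * \<epsilon>' / d = \<epsilon>"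
      using \<open>\<epsilon> > 0\<close> by (simp add: K_def \<gamma>_def d_def \<epsilon>'_def power2_eq_square)
    ultimately show ?thesis unfolding powr by auto
  qed
  moreover have "0 < \<delta>" using c X by (simp add: \<delta>_def)
  ultimately show ?thesis by blast
qed

end
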